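(* Let $(\mathbf X,\mathbf A,\{\mathbf A(x)\},Q,c)$ be a Markov control process, $w:\mathbf X\to[1,\infty)$ measurable, $\mathcal R$ a risk map on it (acting on $\mathscr B_w$), and $\alpha\in[0,1)$. Assume: (1) there exist nonnegative constants $\overline c$ and $\overline w$ with $1\le\overline w<1/\alpha$ (where $1/0:=+\infty$) such that for all $x\in\mathbf X$: $\sup_{a\in\mathbf A(x)}|c(x,a)|\le\overline c\,w(x)$ and $\sup_{a\in\mathbf A(x)}\overline{\mathcal R^\sharp}(w|x,a)\le\overline w\,w(x)$; (2) for each $x\in\mathbf X$: $a\mapsto c(x,a)$ is lower semicontinuous on $\mathbf A(x)$; $\mathbf A(x)$ is compact; and $a\mapsto\mathcal R(u|x,a)$ is continuous on $\mathbf A(x)$ for every $u\in\mathscr B_w$. Let $v^*$ be the unique fixed point in $\mathscr B_w$ of $\mathcal F_\alpha$, i.e. the unique $v^*\in\mathscr B_w$ with $$v^*(x)=\min_{a\in\mathbf A(x)}\{c(x,a)+\alpha\mathcal R(v^*|x,a)\}\quad\text{for all }x\in\mathbf X.$$ Then $v^*=J_\alpha^*$, the optimal discounted total risk.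
   Context: Markov control process: $\mathbf X,\mathbf A$ are Borel spaces (Borel subsets of complete separable metric spaces); for each $x\in\mathbf X$, $\mathbf A(x)\subset\mathbf A$ is a nonempty Borel set of feasible actions; $\mathbf K=\{(x,a):x\in\mathbf X,a\in\mathbf A(x)\}$ is a Borel subset of $\mathbf X\times\mathbf A$; $Q$ is a stochastic kernel on $\mathbf X$ given $\mathbf K$; $c:\mathbf K\to\mathbb R$ is measurable. $\Delta$ is the set of stochastic kernels $\pi$ on $\mathbf A$ given $\mathbf X$ with $\pi(\mathbf A(x)|x)=1$ for all $x$. Markov policies are sequences $\boldsymbol\pi=[\pi_0,\pi_1,\ldots]$ in $\Delta$; $\Pi_M=\Delta^\infty$ is the set of them. $c^\pi(x)=\int_{\mathbf A(x)}c(x,a)\pi(da|x)$. $\mathscr B_w$ is the space of measurable $u:\mathbf X\to\mathbb R$ with $\|u\|_w=\sup_x|u(x)|/w(x)<\infty$. A real-valued risk measure on $\mathscr B_w$ is a map $\nu:\mathscr B_w\to\mathbb R$ with: $\nu(v)\le\nu(u)$ if $v\le u$ pointwise; $\nu(v+r)=\nu(v)+r$ for constants $r\in\mathbb R$; $\nu(0)=0$. A risk map on the Markov control process is a function $\mathcal R(v|x,a)$, $v\in\mathscr B_w$, $(x,a)\in\mathbf K$, such that $\mathcal R(\cdot|x,a)$ is a real-valued risk measure on $\mathscr B_w$ for each $(x,a)\in\mathbf K$ and $\mathcal R(v|\cdot)$ is a real-valued measurable function on $\mathbf K$ for each $v$. For $\pi\in\Delta$, $\mathcal R^\pi(v|x)=\int_{\mathbf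 A(x)}\pi(da|x)\mathcal R(v|x,a)$. Put $\mathcal R^\sharp(v|x,a)=\sup_{u\in\mathscr B_w}\{\mathcal R(v+u|x,a)-\mathcal R(u|x,a)\}\in\mathbb R\cup\{\infty\}$ and $\overline{\mathcal R^\sharp}(v|x,a)=\sup_{\lambda\in\mathbb R,\lambda\neq0}\mathcal R^\sharp(\lambda v|x,a)/\lambda$. $\mathcal F^\pi_\alpha(v)=c^\pi+\alpha\mathcal R^\pi(v)$ and $\mathcal F_\alpha(v)(x)=\inf_{\pi\in\Delta}\mathcal F^\pi_\alpha(v)(x)=\inf_{a\in\mathbf A(x)}\{c(x,a)+\alpha\mathcal R(v|x,a)\}$. Under the assumptions of the claim $\mathcal F_\alpha$ is a contraction of the Banach space $\mathscr B_w$, so $v^*$ is well defined. For $\boldsymbol\pi\in\Pi_M$, $J_{\alpha,T}(x,\boldsymbol\pi)=c^{\pi_0}(x)+\alpha\mathcal R^{\pi_0}_x\big(c^{\pi_1}+\alpha\mathcal R^{\pi_1}(c^{\pi_2}+\cdots+\alpha\mathcal R^{\pi_{T-1}}(c^{\pi_T})\cdots)\big)$, where $\mathcal R^{\pi}_x(v)=\mathcal R^\pi(v|x)$; $J_\alpha(x,\boldsymbol\pi)=\lim_{T\to\infty}J_{\alpha,T}(x,\boldsymbol\pi)$ (the limit exists under the assumptions); $J^*_\alpha(x)=\inf_{\boldsymbol\pi\in\Pi_M}J_\alpha(x,\boldsymbol\pi)$. *)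

theory Defs
  imports "HOL-Probability.Probability"
begin

text \<open>
  The state space \<open>X\<close> and the action space \<open>A\<close> are Borel subsets of Polish types, with the trace
  Borel \<open>\<sigma>\<close>-algebras. Functions on \<open>X\<close> (on \<open>K = Sigma X As\<close>) are total HOL functions of which only
  the values on \<open>X\<close> (on \<open>K\<close>) are constrained or used; accordingly, equality of functions on \<open>X\<close> is
  stated pointwise on \<open>X\<close>. Stochastic kernels are measurable maps into the Giry space of
  probability measures.
\<close>

abbreviation bor :: "'z::topological_space set \<Rightarrow> 'z measure" where
  "bor S \<equiv> restrict_space borel S"

locale markov_control_process =
  fixes X :: "'x::polish_space set"
    and A :: "'a::polish_space set"
    and As :: "'x \<Rightarrow> 'a set"
    and Q :: "'x \<times> 'a \<Rightarrow> 'x measure"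
    and c :: "'x \<times> 'a \<Rightarrow> real"
  assumes borel_X: "X \<in> sets borel"
    and borel_A: "A \<in> sets borel"
    and As: "\<And>x. x \<in> X \<Longrightarrow> As x \<noteq> {} \<and> As x \<subseteq> A \<and> As x \<in> sets borel"
    and borel_K: "Sigma X As \<in> sets borel"
    and kernel_Q: "Q \<in> bor (Sigma X As) \<rightarrow>\<^sub>M prob_algebra (bor X)"
    and measurable_c: "c \<in> borel_measurable (bor (Sigma X As))"

definition Bw :: "'x::polish_space set \<Rightarrow> ('x \<Rightarrow> real) \<Rightarrow> ('x \<Rightarrow> real) set" where
  "Bw X w = {u \<in> borel_measurable (bor X). bdd_above ((\<lambda>x. \<bar>u x\<bar> / w x) ` X)}"

text \<open>Since monotonicity only compares values on \<open>X\<close>, \<open>\<nu> v\<close> depends on \<open>v\<close> only through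
  its restriction to \<open>X\<close>.\<close>

definition real_risk_measure ::
  "'x::polish_space set \<Rightarrow> ('x \<Rightarrow> real) \<Rightarrow> (('x \<Rightarrow> real) \<Rightarrow> real) \<Rightarrow> bool" where
  "real_risk_measure X w \<nu> \<longleftrightarrow>
     (\<forall>u\<in>Bw X w. \<forall>v\<in>Bw X w. (\<forall>x\<in>X. v x \<le> u x) \<longrightarrow> \<nu> v \<le> \<nu> u) \<and>
     (\<forall>v\<in>Bw X w. \<forall>r. \<nu> (\<lambda>x. v x + r) = \<nu> v + r) \<and>
     \<nu> (\<lambda>x. 0) = 0"

definition risk_map ::
  "'x::polish_space set \<Rightarrow> ('x \<Rightarrow> 'a::polish_space set) \<Rightarrow> ('x \<Rightarrow> real) \<Rightarrow>
   (('x \<Rightarrow> real) \<Rightarrow> 'x \<times> 'a \<Rightarrow> real) \<Rightarrow> bool" where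
  "risk_map X As w R \<longleftrightarrow>
     (\<forall>p\<in>Sigma X As. real_risk_measure X w (\<lambda>v. R v p)) \<and>
     (\<forall>v\<in>Bw X w. R v \<in> borel_measurable (bor (Sigma X As)))"

definition Rsharp ::
  "'x::polish_space set \<Rightarrow> ('x \<Rightarrow> real) \<Rightarrow> (('x \<Rightarrow> real) \<Rightarrow> 'x \<times> 'a \<Rightarrow> real) \<Rightarrow>
   ('x \<Rightarrow> real) \<Rightarrow> 'x \<times> 'a \<Rightarrow> ereal" where
  "Rsharp X w R v p = (SUP u\<in>Bw X w. ereal (R (\<lambda>y. v y + u y) p - R u p))"

definition Rsharp_bar ::
  "'x::polish_space set \<Rightarrow> ('x \<Rightarrow> real) \<Rightarrow> (('x \<Rightarrow> real) \<Rightarrow> 'x \<times> 'a \<Rightarrow> real) \<Rightarrow>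
   ('x \<Rightarrow> real) \<Rightarrow> 'x \<times> 'a \<Rightarrow> ereal" where
  "Rsharp_bar X w R v p =
     (SUP \<mu>\<in>{\<mu>::real. \<mu> \<noteq> 0}. Rsharp X w R (\<lambda>y. \<mu> * v y) p / ereal \<mu>)"

definition lsc_on :: "'a::topological_space set \<Rightarrow> ('a \<Rightarrow> real) \<Rightarrow> bool" where
  "lsc_on S f \<longleftrightarrow> (\<forall>a\<in>S. \<forall>y<f a. \<forall>\<^sub>F b in at a within S. y < f b)"

definition Delta ::
  "'x::polish_space set \<Rightarrow> 'a::polish_space set \<Rightarrow> ('x \<Rightarrow> 'a set) \<Rightarrow> ('x \<Rightarrow> 'a measure) set" where
  "Delta X A As =
     {\<pi> \<in> bor X \<rightarrow>\<^sub>M prob_algebra (bor A). \<forall>x\<in>X. measure (\<pi> x) (As x) = 1}"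

definition Markov_policies ::
  "'x::polish_space set \<Rightarrow> 'a::polish_space set \<Rightarrow> ('x \<Rightarrow> 'a set) \<Rightarrow>
   (nat \<Rightarrow> 'x \<Rightarrow> 'a measure) set" where
  "Markov_policies X A As = {ps. \<forall>n. ps n \<in> Delta X A As}"

text \<open>The policy averages \<open>c\<^sup>\<pi>\<close> and \<open>R\<^sup>\<pi>\<close>.\<close>

definition cpol ::
  "('x \<Rightarrow> 'a set) \<Rightarrow> ('x \<times> 'a \<Rightarrow> real) \<Rightarrow> ('x \<Rightarrow> 'a measure) \<Rightarrow> 'x \<Rightarrow> real" where
  "cpol As c \<pi> x = (LINT a:As x|\<pi> x. c (x, a))"

definition Rpol ::
  "('x \<Rightarrow> 'a set) \<Rightarrow> (('x \<Rightarrow> real) \<Rightarrow> 'x \<times> 'a \<Rightarrow> real) \<Rightarrow> ('x \<Rightarrow> 'a measure) \<Rightarrow>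
   ('x \<Rightarrow> real) \<Rightarrow> 'x \<Rightarrow> real" where
  "Rpol As R \<pi> v x = (LINT a:As x|\<pi> x. R v (x, a))"

definition Fpol ::
  "('x \<Rightarrow> 'a set) \<Rightarrow> ('x \<times> 'a \<Rightarrow> real) \<Rightarrow> (('x \<Rightarrow> real) \<Rightarrow> 'x \<times> 'a \<Rightarrow> real) \<Rightarrow> real \<Rightarrow>
   ('x \<Rightarrow> 'a measure) \<Rightarrow> ('x \<Rightarrow> real) \<Rightarrow> 'x \<Rightarrow> real" where
  "Fpol As c R \<alpha> \<pi> v x = cpol As c \<pi> x + \<alpha> * Rpol As R \<pi> v x"

definition Fopt ::
  "'x::polish_space set \<Rightarrow> 'a::polish_space set \<Rightarrow> ('x \<Rightarrow> 'a set) \<Rightarrow> ('x \<times> 'a \<Rightarrow> real) \<Rightarrow>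
   (('x \<Rightarrow> real) \<Rightarrow> 'x \<times> 'a \<Rightarrow> real) \<Rightarrow> real \<Rightarrow> ('x \<Rightarrow> real) \<Rightarrow> 'x \<Rightarrow> real" where
  "Fopt X A As c R \<alpha> v x = (INF \<pi>\<in>Delta X A As. Fpol As c R \<alpha> \<pi> v x)"

text \<open>\<open>JT As c R \<alpha> T ps\<close> is the nested expression
  \<open>c\<^bsup>\<pi>0\<^esup> + \<alpha> R\<^bsup>\<pi>0\<^esup>(c\<^bsup>\<pi>1\<^esup> + \<dots> + \<alpha> R\<^bsup>\<pi>(T-1)\<^esup>(c\<^bsup>\<pi>T\<^esup>)\<dots>)\<close>; the recursion peels off the
  outermost layer, shifting the policy by one step.\<close>

primrec JT ::
  "('x \<Rightarrow> 'a set) \<Rightarrow> ('x \<times> 'a \<Rightarrow> real) \<Rightarrow> (('x \<Rightarrow> real) \<Rightarrow> 'x \<times> 'a \<Rightarrow> real) \<Rightarrow> real \<Rightarrow>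
   nat \<Rightarrow> (nat \<Rightarrow> 'x \<Rightarrow> 'a measure) \<Rightarrow> 'x \<Rightarrow> real" where
  "JT As c R \<alpha> 0 ps = cpol As c (ps 0)"
| "JT As c R \<alpha> (Suc T) ps =
     (\<lambda>x. cpol As c (ps 0) x + \<alpha> * Rpol As R (ps 0) (JT As c R \<alpha> T (\<lambda>n. ps (Suc n))) x)"

text \<open>The real-valued \<open>lim\<close> and \<open>INF\<close> are meaningful under the assumptions on \<open>R\<close> and \<open>c\<close> used with
  them, which make \<open>JT\<close> converge and bound all quantities by a multiple of the weight function.\<close>

definition Jdisc ::
  "('x \<Rightarrow> 'a set) \<Rightarrow> ('x \<times> 'a \<Rightarrow> real) \<Rightarrow> (('x \<Rightarrow> real) \<Rightarrow> 'x \<times> 'a \<Rightarrow> real) \<Rightarrow> real \<Rightarrow>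
   (nat \<Rightarrow> 'x \<Rightarrow> 'a measure) \<Rightarrow> 'x \<Rightarrow> real" where
  "Jdisc As c R \<alpha> ps x = lim (\<lambda>T. JT As c R \<alpha> T ps x)"

definition Jopt ::
  "'x::polish_space set \<Rightarrow> 'a::polish_space set \<Rightarrow> ('x \<Rightarrow> 'a set) \<Rightarrow> ('x \<times> 'a \<Rightarrow> real) \<Rightarrow>
   (('x \<Rightarrow> real) \<Rightarrow> 'x \<times> 'a \<Rightarrow> real) \<Rightarrow> real \<Rightarrow> 'x \<Rightarrow> real" where
  "Jopt X A As c R \<alpha> x = (INF ps\<in>Markov_policies X A As. Jdisc As c R \<alpha> ps x)"

end

theory Submission
  imports Defs
begin

text \<open>
  The weighted bound on \<open>Rsharp_bar\<close> says that \<open>u \<le> v + d w\<close> implies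
  \<open>R u (x, a) \<le> R v (x, a) + d wbar w x\<close>; so all operators \<open>F\<^sup>\<pi>\<close> and \<open>F\<close> are monotone and
  contract the weighted norm by \<open>\<gamma> = \<alpha> wbar < 1\<close>. As \<open>R 0 = 0\<close>, the functional \<open>J\<^sub>T\<close> is the
  \<open>(T + 1)\<close>-fold composition of operators \<open>F\<^sup>\<pi>\<close> applied to \<open>0\<close>. The fixed point \<open>v\<close> of \<open>F\<close> satisfies
  \<open>v \<le> F\<^sup>\<pi> v\<close> for all \<open>\<pi>\<close>, with equality for a greedy selector; iterating gives
  \<open>v \<le> J\<^sub>T + O(\<gamma>\<^sup>T) w\<close> for every policy and \<open>J\<^sub>T \<rightarrow> v\<close> for the stationary greedy one.

  The real difficulty is the measurability of \<open>F v\<close> and of the greedy selector (already the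
  existence of any kernel in \<open>Delta\<close>): it rests on the theorem that a Borel set with compact
  sections has a Borel projection. This follows from Novikov's separation theorem, which exhibits
  the complement of such a set as a countable union of Borel rectangles with open second factor;
  compactness (of the Hilbert cube, in which the second factor is embedded) then expresses emptiness
  of a section by finitely many of these rectangles.
\<close>

section \<open>Analytic sets and separation\<close>

text \<open>Allowing any closed subset of Baire space as domain makes the empty set analytic and
  spares a retraction of Baire space onto \<open>C\<close>.\<close>

definition analytic_set :: "'z::topological_space set \<Rightarrow> bool" where
  "analytic_set S \<longleftrightarrow>
     (\<exists>(C :: (nat \<Rightarrow> nat) set) f. closed C \<and> continuous_on C f \<and> S = f ` C)"

lemma analytic_setI:
  fixes C :: "(nat \<Rightarrow> nat) set"
  shows "closed C \<Longrightarrow> continuous_on C f \<Longrightarrow> S = f ` C \<Longrightarrow> analytic_set S"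
  unfolding analytic_set_def by blast

lemma analytic_setE:
  assumes "analytic_set S"
  obtains C :: "(nat \<Rightarrow> nat) set" and f where "closed C" "continuous_on C f" "S = f ` C"
  using assms unfolding analytic_set_def by blast

lemma analytic_set_continuous_image:
  assumes "analytic_set S" "continuous_on S g"
  shows "analytic_set (g ` S)"
  using assms(1)
proof (rule analytic_setE)
  fix C :: "(nat \<Rightarrow> nat) set" and f
  assume C: "closed C" "continuous_on C f" "S = f ` C"
  show ?thesis
  proof (rule analytic_setI[of C "g \<circ> f"])
    show "continuous_on C (g \<circ> f)"
      using C assms(2) by (intro continuous_on_compose) auto
  qed (use C in auto)
qed

lemma continuous_on_coordinate:
  "continuous_on S (\<lambda>\<alpha> :: nat \<Rightarrow> nat. d (\<alpha> k))"
  by (rule continuous_on_compose2[of UNIV d]) (auto intro: continuous_on_product_then_coordinatewise)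

lemma dense_sequence_exists:
  obtains d :: "nat \<Rightarrow> 'z::{metric_space, second_countable_topology}"
  where "\<And>x e. e > 0 \<Longrightarrow> \<exists>n. dist x (d n) < e"
proof -
  obtain D :: "'z set" where D: "countable D" "\<And>X. open X \<Longrightarrow> X \<noteq> {} \<Longrightarrow> \<exists>d\<in>D. d \<in> X"
    using countable_dense_exists[where 'a='z] by blast
  have ne: "D \<noteq> {}" using D(2)[of UNIV] by auto
  show ?thesis
  proof
    fix x :: 'z and e :: real assume "e > 0"
    then obtain y where "y \<in> D" "y \<in> ball x e" using D(2)[of "ball x e"] by fastforce
    then show "\<exists>n. dist x (from_nat_into D n) < e"
      using D(1) by (metis from_nat_into_surj mem_ball)
  qed
qed

text \<open>A point is coded by the indices of a rapidly converging sequence of members of a dense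
  sequence. Rapid convergence is a closed condition on the code, and the limit depends continuously
  on it.\<close>

lemma analytic_set_closed:
  fixes S :: "'z::{complete_space, second_countable_topology} set"
  assumes "closed S"
  shows "analytic_set S"
proof -
  obtain d :: "nat \<Rightarrow> 'z" where d: "\<And>x e. e > 0 \<Longrightarrow> \<exists>n. dist x (d n) < e"
    using dense_sequence_exists by blast
  \<comment> \<open>The triangle inequality gives this bound as soon as the n-th term lies within
    \<open>(1/2)^n\<close> of one fixed point, so every point of the space has a code.\<close>
  define C where "C = {\<alpha> :: nat \<Rightarrow> nat. \<forall>m n. dist (d (\<alpha> m)) (d (\<alpha> n)) \<le> (1/2)^m + (1/2)^n}"
  define f where "f \<alpha> = lim (\<lambda>n. d (\<alpha> n))" for \<alpha> :: "nat \<Rightarrow> nat"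
  have clC: "closed C"
    unfolding C_def
    by (intro closed_Collect_all closed_Collect_le continuous_on_dist continuous_on_coordinate continuous_on_const)
  have half: "(\<lambda>n. (1/2::real)^n) \<longlonglongrightarrow> 0"
    by (rule LIMSEQ_realpow_zero) auto
  have lim: "(\<lambda>n. d (\<alpha> n)) \<longlonglongrightarrow> f \<alpha>" if "\<alpha> \<in> C" for \<alpha>
  proof -
    have "Cauchy (\<lambda>n. d (\<alpha> n))"
    proof (rule metric_CauchyI)
      fix e :: real assume "e > 0"
      then obtain N where N: "\<And>n. n \<ge> N \<Longrightarrow> (1/2::real)^n < e/2"
        using order_tendstoD(2)[OF half, of "e/2"] unfolding eventually_sequentially by auto
      show "\<exists>M. \<forall>m\<ge>M. \<forall>n\<ge>M. dist (d (\<alpha> m)) (d (\<alpha> n)) < e"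
      proof (intro exI allI impI)
        fix m n assume "N \<le> m" "N \<le> n"
        have "dist (d (\<alpha> m)) (d (\<alpha> n)) \<le> (1/2)^m + (1/2)^n" using that unfolding C_def by auto
        also have "\<dots> < e" using N[OF \<open>N \<le> m\<close>] N[OF \<open>N \<le> n\<close>] by simp
        finally show "dist (d (\<alpha> m)) (d (\<alpha> n)) < e" .
      qed
    qed
    then show ?thesis unfolding f_def by (simp add: Cauchy_convergent_iff convergent_LIMSEQ_iff)
  qed
  have near: "dist (d (\<alpha> m)) (f \<alpha>) \<le> (1/2)^m" if "\<alpha> \<in> C" for \<alpha> m
  proof (rule LIMSEQ_le)
    show "(\<lambda>n. dist (d (\<alpha> m)) (d (\<alpha> n))) \<longlonglongrightarrow> dist (d (\<alpha> m)) (f \<alpha>)"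
      by (intro tendsto_intros lim that)
    show "(\<lambda>n. (1/2)^m + (1/2::real)^n) \<longlonglongrightarrow> (1/2)^m"
      using tendsto_add[OF tendsto_const half, of "(1/2)^m"] by simp
    show "\<exists>N. \<forall>n\<ge>N. dist (d (\<alpha> m)) (d (\<alpha> n)) \<le> (1/2)^m + (1/2)^n"
      using that unfolding C_def by auto
  qed
  \<comment> \<open>By \<open>near\<close> the maps reading a single coordinate converge to
    \<open>f\<close> uniformly on \<open>C\<close>.\<close>
  have cont: "continuous_on C f"
  proof (rule uniform_limit_theorem[of _ "\<lambda>n \<alpha>. d (\<alpha> n)" sequentially])
    show "uniform_limit C (\<lambda>n \<alpha>. d (\<alpha> n)) f sequentially"
    proof (rule uniform_limitI)
      fix e :: real assume "e > 0"
      then have "\<forall>\<^sub>F n in sequentially. (1/2::real)^n < e" by (rule order_tendstoD(2)[OF half])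
      then show "\<forall>\<^sub>F n in sequentially. \<forall>\<alpha>\<in>C. dist (d (\<alpha> n)) (f \<alpha>) < e"
        by eventually_elim (use near in \<open>fastforce intro: le_less_trans\<close>)
    qed
  qed (auto intro: always_eventually continuous_on_coordinate)
  have "closed (C \<inter> f -` S)" by (rule continuous_closed_preimage[OF cont clC assms])
  moreover have "continuous_on (C \<inter> f -` S) f" using cont by (rule continuous_on_subset) auto
  moreover have "S = f ` (C \<inter> f -` S)"
  proof
    show "S \<subseteq> f ` (C \<inter> f -` S)"
    proof
      fix x assume "x \<in> S"
      obtain \<alpha> where \<alpha>: "\<And>n. dist x (d (\<alpha> n)) < (1/2)^n"
        using d[of "(1/2)^_" x] by (metis zero_less_power half_gt_zero zero_less_one)
      have "dist (d (\<alpha> m)) (d (\<alpha> n)) \<le> (1/2)^m + (1/2)^n" for m n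
        using dist_triangle2[of "d (\<alpha> m)" "d (\<alpha> n)" x] \<alpha>[of m] \<alpha>[of n]
        by (simp add: dist_commute)
      then have "\<alpha> \<in> C" unfolding C_def by blast
      moreover have "(\<lambda>n. d (\<alpha> n)) \<longlonglongrightarrow> x"
      proof (rule metric_LIMSEQ_I)
        fix e :: real assume "e > 0"
        then have "\<forall>\<^sub>F n in sequentially. (1/2::real)^n < e" by (rule order_tendstoD(2)[OF half])
        then show "\<exists>N. \<forall>n\<ge>N. dist (d (\<alpha> n)) x < e"
          unfolding eventually_sequentially using \<alpha> by (metis dist_commute less_trans)
      qed
      ultimately have "f \<alpha> = x" using lim LIMSEQ_unique by blast
      with \<open>\<alpha> \<in> C\<close> \<open>x \<in> S\<close> show "x \<in> f ` (C \<inter> f -` S)" by auto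
    qed
  qed auto
  ultimately show ?thesis by (rule analytic_setI)
qed

text \<open>The first entry of a code names the member of the family, and the remaining entries code
  a point of that member.\<close>

lemma analytic_set_UN:
  fixes S :: "nat \<Rightarrow> 'z::topological_space set"
  assumes "\<And>n. analytic_set (S n)"
  shows "analytic_set (\<Union>n. S n)"
proof -
  obtain C :: "nat \<Rightarrow> (nat \<Rightarrow> nat) set" and f where
    C: "\<And>n. closed (C n)" and f: "\<And>n. continuous_on (C n) (f n)" and S: "\<And>n. S n = f n ` C n"
    using assms unfolding analytic_set_def by metis
  define sh where "sh \<alpha> = (\<lambda>k. \<alpha> (Suc k))" for \<alpha> :: "nat \<Rightarrow> nat"
  have csh: "continuous_on T sh" for T
    unfolding sh_def by (intro continuous_on_coordinatewise_then_product continuous_on_coordinate)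
  define D where "D = {\<alpha>. sh \<alpha> \<in> C (\<alpha> 0)}"
  have pre: "open {\<alpha> :: nat \<Rightarrow> nat. \<alpha> 0 \<in> A}" for A
    using open_vimage[OF discrete_topology_class.open_discrete[of A] continuous_on_coordinate[of UNIV "\<lambda>k. k" 0]]
    by (simp add: vimage_def)
  \<comment> \<open>\<open>D\<close> is a conjunction over n of implications: if entry 0 is n, then
    the tail lies in \<open>C n\<close>. Both alternatives are closed because entry 0 is
    discrete.\<close>
  have "closed {\<alpha> :: nat \<Rightarrow> nat. \<alpha> 0 \<noteq> n}" for n
    using pre[of "{n}"] by (simp add: closed_def Collect_neg_eq[symmetric])
  moreover have "closed (sh -` C n)" for n
    using C csh[of UNIV] by (rule closed_vimage)
  ultimately have "closed (\<Inter>n. {\<alpha>. \<alpha> 0 \<noteq> n} \<union> sh -` C n)" by blast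
  also have "(\<Inter>n. {\<alpha>. \<alpha> 0 \<noteq> n} \<union> sh -` C n) = D" unfolding D_def by auto
  finally have "closed D" .
  moreover have "continuous_on D (\<lambda>\<alpha>. f (\<alpha> 0) (sh \<alpha>))"
    unfolding continuous_on_topological
  proof (intro ballI allI impI)
    fix \<alpha> B assume \<alpha>: "\<alpha> \<in> D" and B: "open B" "f (\<alpha> 0) (sh \<alpha>) \<in> B"
    have "sh \<alpha> \<in> C (\<alpha> 0)" using \<alpha> unfolding D_def by simp
    from f[of "\<alpha> 0", unfolded continuous_on_topological, rule_format, OF this B]
    obtain A where A: "open A" "sh \<alpha> \<in> A"
      "\<And>y. y \<in> C (\<alpha> 0) \<Longrightarrow> y \<in> A \<Longrightarrow> f (\<alpha> 0) y \<in> B"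
      by blast
    have "open (sh -` A)" using A(1) csh[of UNIV] by (rule open_vimage)
    \<comment> \<open>Entry 0 is locally constant, so near \<alpha> only the continuity of the
      single map \<open>f (\<alpha> 0)\<close> matters.\<close>
    then have "open ({\<beta>. \<beta> 0 \<in> {\<alpha> 0}} \<inter> sh -` A)" using pre[of "{\<alpha> 0}"] by (intro open_Int)
    moreover have "\<alpha> \<in> {\<beta>. \<beta> 0 \<in> {\<alpha> 0}} \<inter> sh -` A" using A by auto
    moreover have "\<forall>y\<in>D. y \<in> {\<beta>. \<beta> 0 \<in> {\<alpha> 0}} \<inter> sh -` A \<longrightarrow> f (y 0) (sh y) \<in> B"
      using A(3) unfolding D_def by auto
    ultimately show "\<exists>A. open A \<and> \<alpha> \<in> A \<and> (\<forall>y\<in>D. y \<in> A \<longrightarrow> f (y 0) (sh y) \<in> B)" by blast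
  qed
  moreover have "(\<Union>n. S n) = (\<lambda>\<alpha>. f (\<alpha> 0) (sh \<alpha>)) ` D"
  proof
    show "(\<Union>n. S n) \<subseteq> (\<lambda>\<alpha>. f (\<alpha> 0) (sh \<alpha>)) ` D"
    proof
      fix z assume "z \<in> (\<Union>n. S n)"
      then obtain n \<beta> where "\<beta> \<in> C n" "z = f n \<beta>" unfolding S by blast
      then show "z \<in> (\<lambda>\<alpha>. f (\<alpha> 0) (sh \<alpha>)) ` D"
        by (intro image_eqI[of _ _ "case_nat n \<beta>"]) (auto simp: D_def sh_def)
    qed
  qed (auto simp: S D_def)
  ultimately show ?thesis by (rule analytic_setI)
qed

text \<open>The pairing function interleaves one code for each member into a single code. That all
  of them code the same point is a closed condition, since the space is Hausdorff.\<close>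

lemma analytic_set_INT:
  fixes S :: "nat \<Rightarrow> 'z::t2_space set"
  assumes "\<And>n. analytic_set (S n)"
  shows "analytic_set (\<Inter>n. S n)"
proof -
  obtain C :: "nat \<Rightarrow> (nat \<Rightarrow> nat) set" and f where
    C: "\<And>n. closed (C n)" and f: "\<And>n. continuous_on (C n) (f n)" and S: "\<And>n. S n = f n ` C n"
    using assms unfolding analytic_set_def by metis
  define pr where "pr n \<alpha> = (\<lambda>k. \<alpha> (prod_encode (n, k)))" for n and \<alpha> :: "nat \<Rightarrow> nat"
  have cpr: "continuous_on T (pr n)" for T n
    unfolding pr_def by (intro continuous_on_coordinatewise_then_product continuous_on_coordinate)
  define E where "E = (\<Inter>n. pr n -` C n)"
  have "closed (pr n -` C n)" for n
    using C cpr[of UNIV] by (rule closed_vimage)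
  then have "closed E" unfolding E_def by blast
  have fE: "continuous_on E (\<lambda>\<alpha>. f n (pr n \<alpha>))" for n
    by (rule continuous_on_compose2[OF f cpr]) (auto simp: E_def)
  define D where "D = (\<Inter>n. {\<alpha>\<in>E. f n (pr n \<alpha>) = f 0 (pr 0 \<alpha>)})"
  have "closed {\<alpha>\<in>E. f n (pr n \<alpha>) = f 0 (pr 0 \<alpha>)}" for n
  proof -
    have "closed (E \<inter> (\<lambda>\<alpha>. (f n (pr n \<alpha>), f 0 (pr 0 \<alpha>))) -` {y. \<exists>x. y = (x, x)})"
      by (rule continuous_closed_preimage[OF _ \<open>closed E\<close> closed_diagonal])
         (intro continuous_on_Pair fE)
    also have "E \<inter> (\<lambda>\<alpha>. (f n (pr n \<alpha>), f 0 (pr 0 \<alpha>))) -` {y. \<exists>x. y = (x, x)}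
      = {\<alpha>\<in>E. f n (pr n \<alpha>) = f 0 (pr 0 \<alpha>)}" by auto
    finally show ?thesis .
  qed
  then have "closed D" unfolding D_def by blast
  moreover have "continuous_on D (\<lambda>\<alpha>. f 0 (pr 0 \<alpha>))"
    by (rule continuous_on_subset[OF fE]) (auto simp: D_def)
  moreover have "(\<Inter>n. S n) = (\<lambda>\<alpha>. f 0 (pr 0 \<alpha>)) ` D"
  proof
    show "(\<Inter>n. S n) \<subseteq> (\<lambda>\<alpha>. f 0 (pr 0 \<alpha>)) ` D"
    proof
      fix z assume "z \<in> (\<Inter>n. S n)"
      then have "\<forall>n. \<exists>\<beta>. \<beta> \<in> C n \<and> z = f n \<beta>" unfolding S by blast
      then obtain \<beta> where \<beta>: "\<And>n. \<beta> n \<in> C n" "\<And>n. z = f n (\<beta> n)" by metis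
      define \<alpha> where "\<alpha> i = \<beta> (fst (prod_decode i)) (snd (prod_decode i))" for i
      have "pr n \<alpha> = \<beta> n" for n unfolding pr_def \<alpha>_def by simp
      then show "z \<in> (\<lambda>\<alpha>. f 0 (pr 0 \<alpha>)) ` D"
        using \<beta> by (intro image_eqI[of _ _ \<alpha>]) (auto simp: D_def E_def)
    qed
    show "(\<lambda>\<alpha>. f 0 (pr 0 \<alpha>)) ` D \<subseteq> (\<Inter>n. S n)"
    proof clarify
      fix \<alpha> n assume "\<alpha> \<in> D"
      then have "f n (pr n \<alpha>) = f 0 (pr 0 \<alpha>)" "pr n \<alpha> \<in> C n" unfolding D_def E_def by auto
      then show "f 0 (pr 0 \<alpha>) \<in> S n" unfolding S by (metis image_eqI)
    qed
  qed
  ultimately show ?thesis by (rule analytic_setI)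
qed

text \<open>The distance to the complement exhausts an open set by countably many closed
  sets.\<close>

lemma analytic_set_open:
  fixes S :: "'z::{complete_space, second_countable_topology} set"
  assumes "open S"
  shows "analytic_set S"
\<comment> \<open>The distance \<open>infdist\<close> to the empty set is 0 by convention, so the
  whole space is treated apart.\<close>
proof (cases "S = UNIV")
  case True
  then show ?thesis by (simp add: analytic_set_closed)
next
  case False
  have "S = (\<Union>n. {x. 1 / real (Suc n) \<le> infdist x (- S)})"
  proof (intro set_eqI iffI)
    fix x assume "x \<in> S"
    then have "infdist x (- S) > 0"
      using False assms by (intro infdist_pos_not_in_closed) auto
    then obtain n where "1 / real (Suc n) < infdist x (- S)" using nat_approx_posE by blast
    then show "x \<in> (\<Union>n. {x. 1 / real (Suc n) \<le> infdist x (- S)})" using less_imp_le by blast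
  next
    fix x assume "x \<in> (\<Union>n. {x. 1 / real (Suc n) \<le> infdist x (- S)})"
    then obtain n where "1 / real (Suc n) \<le> infdist x (- S)" by blast
    moreover have "0 < 1 / real (Suc n)" by simp
    ultimately have "infdist x (- S) \<noteq> 0" by linarith
    then show "x \<in> S" by (metis ComplI infdist_zero)
  qed
  moreover have "analytic_set (\<Union>n. {x. 1 / real (Suc n) \<le> infdist x (- S)})"
    by (intro analytic_set_UN analytic_set_closed closed_Collect_le continuous_intros)
  ultimately show ?thesis by simp
qed

lemma analytic_set_borel:
  fixes S :: "'z::{complete_space, second_countable_topology} set"
  assumes "S \<in> sets borel"
  shows "analytic_set S"
proof -
  have "S \<in> sigma_sets UNIV {S. open S}" using assms by (simp add: borel_def)
  \<comment> \<open>Analytic sets are not closed under complements; carrying the complement along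
    makes that case of the induction a mere swap.\<close>
  then have "analytic_set S \<and> analytic_set (- S)"
  proof (induction S rule: sigma_sets.induct)
    case (Basic a)
    then show ?case by (auto intro: analytic_set_open analytic_set_closed)
  next
    case Empty
    then show ?case by (simp add: analytic_set_closed)
  next
    case (Compl a)
    then show ?case by (simp flip: Compl_eq_Diff_UNIV)
  next
    case (Union a)
    have "analytic_set (\<Inter>i. - a i)" by (rule analytic_set_INT) (use Union in auto)
    moreover have "analytic_set (\<Union>i. a i)" by (rule analytic_set_UN) (use Union in auto)
    ultimately show ?case by (simp add: Compl_UN)
  qed
  then show ?thesis ..
qed

section \<open>Separation of analytic sets by Borel sets\<close>

lemma open_nat_fun_contains_cylinder:
  fixes W :: "(nat \<Rightarrow> nat) set"
  assumes "open W" "\<alpha> \<in> W"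
  shows "\<exists>K. \<forall>\<beta>. (\<forall>k<K. \<beta> k = \<alpha> k) \<longrightarrow> \<beta> \<in> W"
proof -
  have "openin (product_topology (\<lambda>i. euclidean) UNIV) W"
    using assms(1) by (simp add: euclidean_product_topology)
  from product_topology_open_contains_basis[OF this assms(2)]
  obtain X where X: "\<alpha> \<in> Pi\<^sub>E UNIV X" "finite {i. X i \<noteq> (UNIV :: nat set)}" "Pi\<^sub>E UNIV X \<subseteq> W"
    by auto
  obtain K where K: "{i. X i \<noteq> UNIV} \<subseteq> {..<K}" using X(2) finite_nat_iff_bounded by blast
  have "\<beta> \<in> W" if "\<forall>k<K. \<beta> k = \<alpha> k" for \<beta>
  proof -
    have "\<beta> i \<in> X i" for i
      using that K X(1) by (cases "X i = UNIV") (auto dest!: subsetD simp: PiE_iff)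
    then show ?thesis using X(3) by (auto simp: PiE_iff)
  qed
  then show ?thesis by blast
qed

definition borel_separable :: "(nat \<Rightarrow> 'z::topological_space set) \<Rightarrow> bool" where
  "borel_separable S \<longleftrightarrow> (\<exists>B. (\<forall>n. S n \<subseteq> B n \<and> B n \<in> sets borel) \<and> (\<Inter>n. B n) = {})"

text \<open>The enclosures of the pieces are united at index \<open>k\<close> and intersected at all
  other indices. Used in contrapositive form: a family that is not separable stays so when
  \<open>T k\<close> is replaced by a suitable piece.\<close>

lemma borel_separable_split:
  fixes S :: "nat \<Rightarrow> nat \<Rightarrow> 'z::topological_space set"
  assumes sep: "\<And>m. borel_separable (S m)"
    and eq: "\<And>m n. n \<noteq> k \<Longrightarrow> T n \<subseteq> S m n"
    and un: "T k \<subseteq> (\<Union>m. S m k)"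
  shows "borel_separable T"
proof -
  have "\<forall>m. \<exists>B. (\<forall>n. S m n \<subseteq> B n \<and> B n \<in> sets borel) \<and> (\<Inter>n. B n) = {}"
    using sep unfolding borel_separable_def by blast
  then obtain B where B: "\<And>m n. S m n \<subseteq> B m n" "\<And>m n. B m n \<in> sets borel" "\<And>m. (\<Inter>n. B m n) = {}"
    by metis
  define B' where "B' n = (if n = k then \<Union>m. B m k else \<Inter>m. B m n)" for n
  have "T n \<subseteq> B' n" for n
    using eq[of n] un B(1) unfolding B'_def by (cases "n = k") (auto, blast+)
  moreover have "B' n \<in> sets borel" for n
    unfolding B'_def using B(2) by (cases "n = k") auto
  moreover have "(\<Inter>n. B' n) = {}"
  proof (rule ccontr)
    assume "(\<Inter>n. B' n) \<noteq> {}"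
    then obtain z where z: "\<And>n. z \<in> B' n" by blast
    then obtain m where "z \<in> B m k" using z[of k] unfolding B'_def by auto
    moreover have "z \<in> B m n" if "n \<noteq> k" for n using z[of n] that unfolding B'_def by auto
    ultimately have "z \<in> (\<Inter>n. B m n)" by (metis INT_I)
    with B(3) show False by auto
  qed
  ultimately show ?thesis unfolding borel_separable_def by blast
qed

text \<open>Novikov's separation theorem. If the family were not separable, then splitting one set at a
  time would produce cylinders shrinking to one branch per set whose images are still not separable.
  The code \<open>prod_encode (n, k)\<close> fixes the order in which the coordinates \<open>k\<close> of the branches for
  the sets \<open>n\<close> are chosen.\<close>

theorem Novikov_separation:
  fixes S :: "nat \<Rightarrow> 'z::t2_space set"
  assumes "\<And>n. analytic_set (S n)" and "(\<Inter>n. S n) = {}"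
  shows "borel_separable S"
proof (rule ccontr)
  assume nonsep: "\<not> borel_separable S"
  obtain C :: "nat \<Rightarrow> (nat \<Rightarrow> nat) set" and f where
    C: "\<And>n. closed (C n)" and f: "\<And>n. continuous_on (C n) (f n)" and S: "\<And>n. S n = f n ` C n"
    using assms(1) unfolding analytic_set_def by metis
  \<comment> \<open>The family after \<open>j\<close> decisions: decision \<open>i\<close> with
    \<open>prod_decode i = (n, k)\<close> fixes entry \<open>k\<close> of the codes for the set
    \<open>n\<close> to be \<open>\<alpha> i\<close>.\<close>
  define P where "P j \<alpha> n = f n ` {\<beta>\<in>C n. \<forall>i<j. fst (prod_decode i) = n \<longrightarrow> \<beta> (snd (prod_decode i)) = \<alpha> i}"
    for j and \<alpha> :: "nat \<Rightarrow> nat" and n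
  have P_cong: "P j \<alpha> = P j \<alpha>'" if "\<And>i. i < j \<Longrightarrow> \<alpha> i = \<alpha>' i" for j \<alpha> \<alpha>'
    unfolding P_def using that by auto
  have "\<exists>a. \<forall>j. \<not> borel_separable (P j (a j)) \<and> (\<forall>i<j. a (Suc j) i = a j i)"
  proof (rule dependent_nat_choice)
    show "\<exists>\<alpha>. \<not> borel_separable (P 0 \<alpha>)"
    proof -
      have "P 0 \<alpha> = S" for \<alpha> unfolding P_def S by auto
      then show ?thesis using nonsep by simp
    qed
  next
    fix \<alpha> j assume "\<not> borel_separable (P j \<alpha>)"
    let ?k = "fst (prod_decode j)" and ?l = "snd (prod_decode j)"
    have "\<exists>m. \<not> borel_separable (P (Suc j) (\<alpha>(j := m)))"
    proof (rule ccontr)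
      assume "\<not> ?thesis"
      then have *: "\<And>m. borel_separable (P (Suc j) (\<alpha>(j := m)))" by blast
      \<comment> \<open>Decision \<open>j\<close> concerns the set \<open>?k\<close> alone, whose
        current piece is the union of its pieces over all values \<open>m\<close> of the new
        entry.\<close>
      have "borel_separable (P j \<alpha>)"
      proof (rule borel_separable_split[OF *, where k="?k"])
        fix m n assume "n \<noteq> ?k"
        then show "P j \<alpha> n \<subseteq> P (Suc j) (\<alpha>(j := m)) n"
          unfolding P_def by (intro image_mono) (auto simp: less_Suc_eq)
      next
        show "P j \<alpha> ?k \<subseteq> (\<Union>m. P (Suc j) (\<alpha>(j := m)) ?k)"
        proof
          fix z assume "z \<in> P j \<alpha> ?k"
          then obtain \<beta> where "\<beta> \<in> C ?k" "z = f ?k \<beta>"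
            "\<forall>i<j. fst (prod_decode i) = ?k \<longrightarrow> \<beta> (snd (prod_decode i)) = \<alpha> i"
            unfolding P_def by blast
          then have "z \<in> P (Suc j) (\<alpha>(j := \<beta> ?l)) ?k"
            unfolding P_def by (intro image_eqI[of _ _ \<beta>]) (auto simp: less_Suc_eq)
          then show "z \<in> (\<Union>m. P (Suc j) (\<alpha>(j := m)) ?k)" by blast
        qed
      qed
      with \<open>\<not> borel_separable (P j \<alpha>)\<close> show False ..
    qed
    then show "\<exists>\<alpha>'. \<not> borel_separable (P (Suc j) \<alpha>') \<and> (\<forall>i<j. \<alpha>' i = \<alpha> i)"
      by (metis fun_upd_other less_irrefl)
  qed
  then obtain a where a: "\<And>j. \<not> borel_separable (P j (a j))" and coh: "\<And>j i. i < j \<Longrightarrow> a (Suc j) i = a j i"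
    by blast
  \<comment> \<open>Entry \<open>i\<close> no longer changes from stage \<open>Suc i\<close> on, so
    the diagonal is the limit of the coherent choices.\<close>
  define \<alpha> where "\<alpha> i = a (Suc i) i" for i
  have "a j i = \<alpha> i" if "i < j" for i j
    using that
  proof (induction j)
    case (Suc j)
    then show ?case using coh[of i j] by (cases "i = j") (auto simp: \<alpha>_def)
  qed simp
  then have nsep: "\<not> borel_separable (P j \<alpha>)" for j
    using a[of j] P_cong[of j "a j" \<alpha>] by simp
  define b where "b n = (\<lambda>k. \<alpha> (prod_encode (n, k)))" for n
  \<comment> \<open>A neighbourhood of the branch \<open>b n\<close> contains a cylinder given by
    finitely many entries; these are all fixed once the stage exceeds their pair codes.\<close>
  have cyl: "\<exists>J. \<forall>j\<ge>J. P j \<alpha> n \<subseteq> f n ` (C n \<inter> W)" if W: "open W" "b n \<in> W" for n W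
  proof -
    obtain K where K: "\<And>\<beta>. (\<forall>k<K. \<beta> k = b n k) \<Longrightarrow> \<beta> \<in> W"
      using open_nat_fun_contains_cylinder[OF W] by blast
    obtain J where J: "\<And>k. k < K \<Longrightarrow> prod_encode (n, k) < J"
    proof
      fix k assume "k < K"
      then show "prod_encode (n, k) < Suc (Max ((\<lambda>k. prod_encode (n, k)) ` {..<K}))"
        by (intro le_imp_less_Suc Max_ge) auto
    qed
    have "P j \<alpha> n \<subseteq> f n ` (C n \<inter> W)" if "j \<ge> J" for j
      unfolding P_def
    proof (intro image_mono subsetI)
      fix \<beta> assume \<beta>: "\<beta> \<in> {\<beta> \<in> C n. \<forall>i<j. fst (prod_decode i) = n \<longrightarrow> \<beta> (snd (prod_decode i)) = \<alpha> i}"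
      have "\<beta> k = b n k" if "k < K" for k
      proof -
        have "prod_encode (n, k) < j" using J[OF that] \<open>j \<ge> J\<close> by simp
        then show ?thesis using \<beta> unfolding b_def by fastforce
      qed
      then show "\<beta> \<in> C n \<inter> W" using \<beta> K by blast
    qed
    then show ?thesis by blast
  qed
  \<comment> \<open>Otherwise some cylinder around \<open>b n\<close> misses the closed set
    \<open>C n\<close>; then one member of the family is empty, and the family is trivially
    separable.\<close>
  have bC: "b n \<in> C n" for n
  proof (rule ccontr)
    assume "b n \<notin> C n"
    then obtain J where "P J \<alpha> n \<subseteq> f n ` (C n \<inter> - C n)"
      using cyl[of "- C n" n] C[of n] open_Compl by blast
    then have "P J \<alpha> n = {}" by auto
    then have "borel_separable (P J \<alpha>)"
      unfolding borel_separable_def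
      by (intro exI[of _ "\<lambda>k. if k = n then {} else UNIV"]) (auto split: if_splits)
    with nsep show False by blast
  qed
  show False
  \<comment> \<open>If all branches have the same image, it is a common point of the
    \<open>S n\<close>. If two images differ, disjoint neighbourhoods enclose two members at a late
    stage, which separates that family.\<close>
  proof (cases "\<forall>n. f n (b n) = f 0 (b 0)")
    case True
    then have "f 0 (b 0) \<in> S n" for n unfolding S using bC[of n] by (metis image_eqI)
    with assms(2) show False by blast
  next
    case False
    then obtain n where n: "f n (b n) \<noteq> f 0 (b 0)" by blast
    then obtain U V where UV: "open U" "open V" "f n (b n) \<in> U" "f 0 (b 0) \<in> V" "U \<inter> V = {}"
      using hausdorff[OF n] by blast
    have nbhd: "\<exists>W. open W \<and> b k \<in> W \<and> f k ` (C k \<inter> W) \<subseteq> U'" if "open U'" "f k (b k) \<in> U'" for k U'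
    proof -
      from f[of k, unfolded continuous_on_topological, rule_format, OF bC that]
      obtain W where "open W" "b k \<in> W" "\<And>y. y \<in> C k \<Longrightarrow> y \<in> W \<Longrightarrow> f k y \<in> U'"
        by blast
      then show ?thesis by (intro exI[of _ W]) auto
    qed
    obtain W1 where W1: "open W1" "b n \<in> W1" "f n ` (C n \<inter> W1) \<subseteq> U" using nbhd[OF UV(1,3)] by blast
    obtain W2 where W2: "open W2" "b 0 \<in> W2" "f 0 ` (C 0 \<inter> W2) \<subseteq> V" using nbhd[OF UV(2,4)] by blast
    obtain J1 where J1: "\<forall>j\<ge>J1. P j \<alpha> n \<subseteq> f n ` (C n \<inter> W1)" using cyl[OF W1(1,2)] by blast
    obtain J2 where J2: "\<forall>j\<ge>J2. P j \<alpha> 0 \<subseteq> f 0 ` (C 0 \<inter> W2)" using cyl[OF W2(1,2)] by blast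
    let ?j = "max J1 J2"
    have sub: "P ?j \<alpha> n \<subseteq> U" "P ?j \<alpha> 0 \<subseteq> V"
      using J1[rule_format, of ?j] J2[rule_format, of ?j] W1(3) W2(3) by auto
    have "n \<noteq> 0" using n by metis
    have "borel_separable (P ?j \<alpha>)"
      unfolding borel_separable_def
    proof (intro exI[of _ "\<lambda>k. if k = n then U else if k = 0 then V else UNIV"] conjI allI)
      show "(\<Inter>k. if k = n then U else if k = 0 then V else UNIV) = {}"
        using UV(5) \<open>n \<noteq> 0\<close> by (auto split: if_splits)
    qed (use sub UV in auto)
    with nsep show False by blast
  qed
qed

text \<open>Repeating \<open>T\<close> at every index but 0 turns the pair into a sequence. As
  \<open>T\<close> lies in all other enclosures, the enclosure of \<open>S\<close> must miss
  it.\<close>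

lemma Lusin_separation:
  fixes S T :: "'z::t2_space set"
  assumes "analytic_set S" "analytic_set T" "S \<inter> T = {}"
  obtains B where "B \<in> sets borel" "S \<subseteq> B" "B \<inter> T = {}"
proof -
  have "borel_separable (\<lambda>n. if n = 0 then S else T)"
  proof (rule Novikov_separation)
    have "(\<Inter>n::nat. if n = 0 then S else T) \<subseteq> S \<inter> T"
    proof
      fix z assume "z \<in> (\<Inter>n::nat. if n = 0 then S else T)"
      from INT_D[OF this, of 0] INT_D[OF this, of 1] show "z \<in> S \<inter> T" by simp_all
    qed
    then show "(\<Inter>n::nat. if n = 0 then S else T) = {}" using assms(3) by blast
  qed (use assms in simp)
  then obtain B :: "nat \<Rightarrow> 'z set"
    where B: "\<And>n. (if n = 0 then S else T) \<subseteq> B n" "\<And>n. B n \<in> sets borel" "(\<Inter>n. B n) = {}"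
    unfolding borel_separable_def by blast
  show ?thesis
  proof
    show "B 0 \<in> sets borel" "S \<subseteq> B 0" using B(1)[of 0] B(2) by auto
    show "B 0 \<inter> T = {}"
    proof (rule ccontr)
      assume "B 0 \<inter> T \<noteq> {}"
      then obtain z where "z \<in> B 0" "z \<in> T" by blast
      moreover have "z \<in> B n" if "n \<noteq> 0" for n using B(1)[of n] that \<open>z \<in> T\<close> by auto
      ultimately have "z \<in> (\<Inter>n. B n)" by (metis INT_I)
      with B(3) show False by simp
    qed
  qed
qed

section \<open>Borel sets with compact sections\<close>

lemma analytic_set_Un:
  assumes "analytic_set S" "analytic_set T"
  shows "analytic_set (S \<union> T)"
proof -
  have "analytic_set (\<Union>n::nat. if n = 0 then S else T)"
    by (rule analytic_set_UN) (use assms in simp)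
  moreover have "(\<Union>n::nat. if n = 0 then S else T) = S \<union> T"
    by (auto split: if_splits)
  ultimately show ?thesis by simp
qed

text \<open>Kunugui--Novikov: in the proof, \<open>- A n\<close> is the (coanalytic) set of all \<open>x\<close> such that \<open>U n\<close>
  misses the section at \<open>x\<close>. Novikov separation cuts the complement of \<open>B\<close> into Borel pieces
  inside \<open>(- A n) \<times> U n\<close>, and Lusin separation enlarges their projections to Borel sets.\<close>

theorem closed_sections_rectangles:
  fixes B :: "('x::{complete_space, second_countable_topology} \<times>
    'z::{complete_space, second_countable_topology}) set"
    and U :: "nat \<Rightarrow> 'z set"
  assumes B: "B \<in> sets borel" and cl: "\<And>x. closed (B `` {x})"
    and U: "topological_basis (range U)"
  obtains D where "\<And>n. D n \<in> sets borel"
    and "\<And>x z. (x, z) \<notin> B \<longleftrightarrow> (\<exists>n. x \<in> D n \<and> z \<in> U n)"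
proof -
  have oU: "open (U n)" for n using U topological_basis_open by blast
  define A where "A n = fst ` (B \<inter> (UNIV \<times> U n))" for n
  have BU: "B \<inter> (UNIV \<times> U n) \<in> sets borel" for n
    by (rule sets.Int[OF B borel_open]) (intro open_Times open_UNIV oU)
  have anA: "analytic_set (A n)" for n
    unfolding A_def
    by (intro analytic_set_continuous_image analytic_set_borel BU continuous_intros)
  \<comment> \<open>The cylinder over a projection is the image of a Borel set in a triple product
    under omission of the middle coordinate.\<close>
  have anA': "analytic_set (A n \<times> (UNIV :: 'z set))" for n
  proof -
    have "analytic_set ((\<lambda>p. (fst (fst p), snd p)) ` ((B \<inter> (UNIV \<times> U n)) \<times> (UNIV :: 'z set)))"
      by (intro analytic_set_continuous_image analytic_set_borel borel_Times BU continuous_intros) auto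
    moreover have "(\<lambda>p. (fst (fst p), snd p)) ` ((B \<inter> (UNIV \<times> U n)) \<times> (UNIV :: 'z set)) = A n \<times> UNIV"
      unfolding A_def by (auto simp: image_iff) force+
    ultimately show ?thesis by simp
  qed
  \<comment> \<open>From index 1 on these are the complements of the rectangles
    \<open>(- A n) \<times> U n\<close>. A point outside \<open>B\<close> lies in one of the
    rectangles, because its closed section misses a basic neighbourhood; so the intersection is
    empty.\<close>
  define S where "S n = (case n of 0 \<Rightarrow> - B | Suc n \<Rightarrow> (A n \<times> UNIV) \<union> (UNIV \<times> - U n))" for n
  have "borel_separable S"
  proof (rule Novikov_separation)
    fix n show "analytic_set (S n)"
    proof (cases n)
      case 0
      then show ?thesis using B unfolding S_def by (auto intro!: analytic_set_borel borel_comp)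
    next
      case (Suc m)
      have "analytic_set ((UNIV :: 'x set) \<times> - U m)"
        using oU by (intro analytic_set_closed closed_Times) auto
      then show ?thesis using Suc anA' unfolding S_def by (simp add: analytic_set_Un)
    qed
  next
    show "(\<Inter>n. S n) = {}"
    proof (rule ccontr)
      assume "(\<Inter>n. S n) \<noteq> {}"
      then obtain x z where xz: "\<And>n. (x, z) \<in> S n" by auto
      from xz[of 0] have "z \<in> - (B `` {x})" unfolding S_def by simp
      with topological_basisE[OF U, of "- (B `` {x})" z] cl[of x]
      obtain n where n: "z \<in> U n" "U n \<subseteq> - (B `` {x})" by (auto simp: open_Compl)
      then have "x \<notin> A n" unfolding A_def by auto
      with n(1) xz[of "Suc n"] show False unfolding S_def by simp
    qed
  qed
  then obtain B' where B': "\<And>n. S n \<subseteq> B' n" "\<And>n. B' n \<in> sets borel" "(\<Inter>n. B' n) = {}"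
    unfolding borel_separable_def by blast
  define E where "E n = - B' (Suc n)" for n
  have E_borel: "E n \<in> sets borel" for n unfolding E_def using B'(2) by (intro borel_comp)
  have E_sub: "E n \<subseteq> (- A n) \<times> U n" for n
    using B'(1)[of "Suc n"] unfolding E_def S_def by auto
  have "\<exists>D. D \<in> sets borel \<and> fst ` E n \<subseteq> D \<and> D \<inter> A n = {}" for n
  proof -
    have "analytic_set (fst ` E n)"
      by (intro analytic_set_continuous_image analytic_set_borel E_borel continuous_intros)
    moreover have "fst ` E n \<inter> A n = {}" using E_sub[of n] by auto
    ultimately show ?thesis using Lusin_separation[OF _ anA] by metis
  qed
  then obtain D where D: "\<And>n. D n \<in> sets borel" "\<And>n. fst ` E n \<subseteq> D n" "\<And>n. D n \<inter> A n = {}"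
    by metis
  show ?thesis
  proof (rule that[OF D(1)])
    fix x z show "(x, z) \<notin> B \<longleftrightarrow> (\<exists>n. x \<in> D n \<and> z \<in> U n)"
    proof
      assume "(x, z) \<notin> B"
      then have "(x, z) \<in> B' 0" using B'(1)[of 0] unfolding S_def by auto
      moreover obtain k where "(x, z) \<notin> B' k" using B'(3) by blast
      ultimately obtain n where "(x, z) \<in> E n" unfolding E_def by (cases k) auto
      then show "\<exists>n. x \<in> D n \<and> z \<in> U n" using D(2) E_sub by force
    next
      assume "\<exists>n. x \<in> D n \<and> z \<in> U n"
      then obtain n where n: "x \<in> D n" "z \<in> U n" by blast
      then have "x \<notin> A n" using D(3) by blast
      then show "(x, z) \<notin> B" using n(2) unfolding A_def by force
    qed
  qed
qed

text \<open>The section at x is empty iff the sets \<open>U n\<close> with x in \<open>D n\<close>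
  cover \<open>H\<close>. By compactness finitely many suffice, and there are only countably many
  finite index sets.\<close>

lemma projection_borel_compact_ambient:
  fixes B :: "('x::{complete_space, second_countable_topology} \<times>
    'z::{complete_space, second_countable_topology}) set"
  assumes B: "B \<in> sets borel" and cl: "\<And>x. closed (B `` {x})"
    and H: "compact H" "\<And>x. B `` {x} \<subseteq> H"
  shows "fst ` B \<in> sets borel"
proof -
  obtain \<U> :: "'z set set" where \<U>: "countable \<U>" "topological_basis \<U>"
    using ex_countable_basis by blast
  have "\<U> \<noteq> {}" using topological_basisE[OF \<U>(2) open_UNIV UNIV_I] by blast
  define U where "U = from_nat_into \<U>"
  have U: "topological_basis (range U)"
    unfolding U_def using range_from_nat_into[OF \<open>\<U> \<noteq> {}\<close> \<U>(1)] \<U>(2) by simp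
  have oU: "open (U n)" for n using U topological_basis_open by blast
  obtain D where D: "\<And>n. D n \<in> sets borel" "\<And>x z. (x, z) \<notin> B \<longleftrightarrow> (\<exists>n. x \<in> D n \<and> z \<in> U n)"
    using closed_sections_rectangles[OF B cl U] by blast
  let ?\<F> = "{F. finite F \<and> H \<subseteq> (\<Union>n\<in>F. U n)}"
  have "- (fst ` B) = (\<Union>F\<in>?\<F>. (\<Inter>n\<in>F. D n))"
  proof (intro set_eqI iffI)
    fix x assume "x \<in> - (fst ` B)"
    then have "\<And>z. (x, z) \<notin> B" by force
    then have "H \<subseteq> (\<Union>n\<in>{n. x \<in> D n}. U n)" using D(2) by auto
    then obtain F where "F \<subseteq> {n. x \<in> D n}" "finite F" "H \<subseteq> (\<Union>n\<in>F. U n)"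
      using compactE_image[OF H(1), of "{n. x \<in> D n}" U] oU by blast
    then show "x \<in> (\<Union>F\<in>?\<F>. (\<Inter>n\<in>F. D n))" by blast
  next
    fix x assume "x \<in> (\<Union>F\<in>?\<F>. (\<Inter>n\<in>F. D n))"
    then obtain F where F: "H \<subseteq> (\<Union>n\<in>F. U n)" "\<And>n. n \<in> F \<Longrightarrow> x \<in> D n" by blast
    have "(x, z) \<notin> B" for z
    proof
      assume "(x, z) \<in> B"
      then have "z \<in> H" using H(2) by blast
      then show False using F D(2) \<open>(x, z) \<in> B\<close> by blast
    qed
    then show "x \<in> - (fst ` B)" by force
  qed
  moreover have "(\<Union>F\<in>?\<F>. (\<Inter>n\<in>F. D n)) \<in> sets borel"
  proof (rule sets.countable_UN'')
    show "countable ?\<F>"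
      by (rule countable_subset[OF _ countable_Collect_finite]) auto
    \<comment> \<open>The empty index set occurs only for empty \<open>H\<close>, and its
      intersection is the whole space.\<close>
    show "(\<Inter>n\<in>F. D n) \<in> sets borel" if "F \<in> ?\<F>" for F
      using that D(1) by (cases "F = {}") (auto intro!: sets.finite_INT)
  qed
  ultimately have "- (fst ` B) \<in> sets borel" by simp
  then show ?thesis using borel_comp by fastforce
qed

text \<open>The first point of the dense sequence within \<open>(1/2)^k\<close> of the value has a
  countable range and depends measurably on the distances; these approximations converge to
  \<open>g\<close>.\<close>

lemma measurable_from_distances:
  fixes d :: "nat \<Rightarrow> 'a::{metric_space, second_countable_topology}"
  assumes dense: "\<And>x e. e > 0 \<Longrightarrow> \<exists>n. dist x (d n) < e"
    and meas: "\<And>n. (\<lambda>x. dist (g x) (d n)) \<in> borel_measurable M"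
  shows "g \<in> borel_measurable M"
proof (rule borel_measurable_LIMSEQ_metric)
  note [measurable] = meas
  show "(\<lambda>x. d (LEAST n. dist (g x) (d n) < (1/2)^k)) \<in> borel_measurable M" for k
    by measurable
  show "(\<lambda>k. d (LEAST n. dist (g x) (d n) < (1/2)^k)) \<longlonglongrightarrow> g x" for x
  proof (rule metric_LIMSEQ_I)
    fix e :: real assume "e > 0"
    then have "\<forall>\<^sub>F k in sequentially. (1/2::real)^k < e"
      by (intro order_tendstoD(2)[OF LIMSEQ_realpow_zero]) auto
    then obtain N where N: "\<And>k. k \<ge> N \<Longrightarrow> (1/2::real)^k < e" unfolding eventually_sequentially by blast
    have "dist (g x) (d (LEAST n. dist (g x) (d n) < (1/2)^k)) < (1/2)^k" for k
      using dense[of "(1/2)^k" "g x"] by (rule_tac LeastI_ex) auto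
    then show "\<exists>N. \<forall>k\<ge>N. dist (d (LEAST n. dist (g x) (d n) < (1/2)^k)) (g x) < e"
      using N by (metis dist_commute less_trans)
  qed
qed

section \<open>Embedding into the Hilbert cube and Borel projections\<close>

lemma compact_hilbert_cube: "compact {z :: nat \<Rightarrow> real. \<forall>n. z n \<in> {0..1}}"
proof -
  have "compactin (product_topology (\<lambda>_. euclidean) UNIV) (PiE (UNIV :: nat set) (\<lambda>_. {0..1::real}))"
    unfolding compactin_PiE by (simp add: compactin_euclidean_iff)
  moreover have "PiE (UNIV :: nat set) (\<lambda>_. {0..1::real}) = {z. \<forall>n. z n \<in> {0..1}}"
    by (auto simp: PiE_iff)
  ultimately show ?thesis by (simp add: euclidean_product_topology)
qed

text \<open>A point is coded by its truncated distances to a dense sequence. The Borel left inverse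
  recovers it as the limit of points of that sequence whose listed distance is small.\<close>

lemma hilbert_cube_embedding:
  obtains e :: "'a::{complete_space, second_countable_topology} \<Rightarrow> nat \<Rightarrow> real" and g
  where "continuous_on UNIV e" "\<And>y n. e y n \<in> {0..1}" "g \<in> borel_measurable borel" "\<And>y. g (e y) = y"
proof -
  obtain d :: "nat \<Rightarrow> 'a" where d: "\<And>x e. e > 0 \<Longrightarrow> \<exists>n. dist x (d n) < e"
    using dense_sequence_exists by blast
  define e where "e y = (\<lambda>n. min 1 (dist y (d n)))" for y
  define f where "f k z = d (LEAST n. z n < (1/2)^k)" for k and z :: "nat \<Rightarrow> real"
  \<comment> \<open>Off the range of \<open>e\<close> the approximations may diverge. The constant
    value there makes the limit exist everywhere, so that \<open>g\<close> is a pointwise limit of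
    Borel maps.\<close>
  define h where "h k z = (if Cauchy (\<lambda>k. f k z) then f k z else d 0)" for k z
  define g where "g z = lim (\<lambda>k. h k z)" for z
  have coord [measurable]: "(\<lambda>z::nat \<Rightarrow> real. z n) \<in> borel_measurable borel" for n
    by (intro borel_measurable_continuous_onI continuous_on_product_coordinates)
  have f [measurable]: "f k \<in> borel_measurable borel" for k
    unfolding f_def by measurable
  have h: "h k \<in> borel_measurable borel" for k
    unfolding h_def by measurable
  show ?thesis
  proof
    show "continuous_on UNIV e"
      unfolding e_def by (intro continuous_on_coordinatewise_then_product continuous_intros)
    show "e y n \<in> {0..1}" for y n unfolding e_def by auto
    show "g \<in> borel_measurable borel"
    proof (rule borel_measurable_LIMSEQ_metric[OF h])
      fix z
      have "Cauchy (\<lambda>k. h k z)" unfolding h_def by (cases "Cauchy (\<lambda>k. f k z)") (auto simp: Cauchy_convergent_iff convergent_const)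
      then show "(\<lambda>k. h k z) \<longlonglongrightarrow> g z"
        unfolding g_def by (simp add: Cauchy_convergent_iff convergent_LIMSEQ_iff)
    qed
    show "g (e y) = y" for y
    proof -
      have near: "dist y (f k (e y)) < (1/2)^k" for k
      proof -
        obtain n where "dist y (d n) < (1/2)^k" using d[of "(1/2)^k" y] by auto
        then have "e y n < (1/2)^k" unfolding e_def by simp
        then have "e y (LEAST n. e y n < (1/2)^k) < (1/2)^k" by (rule LeastI)
        \<comment> \<open>Hence a truncated distance below \<open>(1/2)^k\<close> is the true
          distance.\<close>
        moreover have "(1/2::real)^k \<le> 1" by (simp add: power_le_one)
        ultimately show ?thesis unfolding f_def e_def by simp
      qed
      have conv: "(\<lambda>k. f k (e y)) \<longlonglongrightarrow> y"
      proof (rule metric_LIMSEQ_I)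
        fix r :: real assume "r > 0"
        then have "\<forall>\<^sub>F k in sequentially. (1/2::real)^k < r"
          by (intro order_tendstoD(2)[OF LIMSEQ_realpow_zero]) auto
        then show "\<exists>N. \<forall>k\<ge>N. dist (f k (e y)) y < r"
          unfolding eventually_sequentially using near by (metis dist_commute less_trans)
      qed
      then have "h k (e y) = f k (e y)" for k unfolding h_def using LIMSEQ_imp_Cauchy by auto
      with conv show ?thesis unfolding g_def by (simp add: limI)
    qed
  qed
qed

text \<open>Embedding the second factor puts all sections, still compact, into one compact set
  without changing the projection.\<close>

theorem projection_borel_compact_sections:
  fixes B :: "('x::{complete_space, second_countable_topology} \<times>
    'a::{complete_space, second_countable_topology}) set"
  assumes B: "B \<in> sets borel" and cpt: "\<And>x. compact (B `` {x})"
  shows "fst ` B \<in> sets borel"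
proof -
  obtain e :: "'a \<Rightarrow> nat \<Rightarrow> real" and g where e: "continuous_on UNIV e" "\<And>y n. e y n \<in> {0..1}"
    and g [measurable]: "g \<in> borel_measurable borel" and ge: "\<And>y. g (e y) = y"
    using hilbert_cube_embedding by blast
  \<comment> \<open>This is the image of \<open>B\<close> under the embedding, written as a preimage
    under Borel maps and hence visibly Borel; the equations say that the second component lies in
    the range of \<open>e\<close>.\<close>
  define B' where "B' = {p. (\<forall>n. e (g (snd p)) n = snd p n) \<and> (fst p, g (snd p)) \<in> B}"
  have sec: "B' `` {x} = e ` (B `` {x})" for x
  proof (intro set_eqI iffI)
    fix z assume "z \<in> B' `` {x}"
    then have "z = e (g z)" "g z \<in> B `` {x}" unfolding B'_def by auto
    then show "z \<in> e ` (B `` {x})" by (rule image_eqI)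
  qed (auto simp: B'_def ge)
  have cptB': "compact (B' `` {x})" for x
    unfolding sec by (rule compact_continuous_image[OF continuous_on_subset[OF e(1)] cpt]) simp
  have fst_B': "(\<lambda>p :: 'x \<times> (nat \<Rightarrow> real). fst p) \<in> borel_measurable borel"
    and snd_B': "(\<lambda>p :: 'x \<times> (nat \<Rightarrow> real). snd p) \<in> borel_measurable borel"
    by (intro borel_measurable_continuous_onI continuous_intros)+
  have coord: "(\<lambda>z::nat \<Rightarrow> real. z n) \<in> borel_measurable borel" for n
    by (intro borel_measurable_continuous_onI continuous_on_product_coordinates)
  have [measurable]: "(\<lambda>p :: 'x \<times> (nat \<Rightarrow> real). snd p n) \<in> borel_measurable borel" for n
    by (rule measurable_compose[OF snd_B' coord])
  have gs: "(\<lambda>p :: 'x \<times> (nat \<Rightarrow> real). g (snd p)) \<in> borel_measurable borel"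
    by (rule measurable_compose[OF snd_B' g])
  have en: "(\<lambda>y. e y n) \<in> borel_measurable borel" for n
    by (rule borel_measurable_continuous_onI[OF continuous_on_product_then_coordinatewise[OF e(1)]])
  have [measurable]: "(\<lambda>p :: 'x \<times> (nat \<Rightarrow> real). e (g (snd p)) n) \<in> borel_measurable borel" for n
    by (rule measurable_compose[OF gs en])
  have "(\<lambda>p. (fst p, g (snd p))) \<in> borel_measurable (borel :: ('x \<times> (nat \<Rightarrow> real)) measure)"
    by (intro borel_measurable_Pair fst_B' gs)
  then have "(\<lambda>p. (fst p, g (snd p))) -` B \<inter> space (borel :: ('x \<times> (nat \<Rightarrow> real)) measure) \<in> sets borel"
    using B by (rule measurable_sets)
  moreover have "{p \<in> space (borel :: ('x \<times> (nat \<Rightarrow> real)) measure). \<forall>n. e (g (snd p)) n = snd p n} \<in> sets borel"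
    by measurable
  ultimately have "{p \<in> space (borel :: ('x \<times> (nat \<Rightarrow> real)) measure). \<forall>n. e (g (snd p)) n = snd p n}
      \<inter> ((\<lambda>p. (fst p, g (snd p))) -` B \<inter> space borel) \<in> sets borel" by (rule sets.Int[rotated])
  also have "{p \<in> space (borel :: ('x \<times> (nat \<Rightarrow> real)) measure). \<forall>n. e (g (snd p)) n = snd p n}
      \<inter> ((\<lambda>p. (fst p, g (snd p))) -` B \<inter> space borel) = B'"
    unfolding B'_def by auto
  finally have "B' \<in> sets borel" .
  then have "fst ` B' \<in> sets borel"
  proof (rule projection_borel_compact_ambient[OF _ _ compact_hilbert_cube])
    show "closed (B' `` {x})" for x using cptB' by (rule compact_imp_closed)
    show "B' `` {x} \<subseteq> {z. \<forall>n. z n \<in> {0..1}}" for x unfolding sec using e(2) by blast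
  qed
  moreover have "fst ` B' = fst ` B"
  proof -
    have "x \<in> fst ` B' \<longleftrightarrow> B' `` {x} \<noteq> {}" "x \<in> fst ` B \<longleftrightarrow> B `` {x} \<noteq> {}" for x by force+
    then show ?thesis unfolding sec by auto
  qed
  ultimately show ?thesis by simp
qed

section \<open>Measurable minimisation and selection\<close>

lemma lsc_on_sublevel_compact:
  fixes f :: "'a::t2_space \<Rightarrow> real"
  assumes "lsc_on S f" "compact S"
  shows "compact {y\<in>S. f y \<le> r}"
proof -
  have "\<exists>T. open T \<and> y \<in> T \<and> (\<forall>b\<in>T. b \<in> S \<longrightarrow> r < f b)" if "y \<in> S" "r < f y" for y
  proof -
    have "\<forall>\<^sub>F b in at y within S. r < f b" using assms(1) that unfolding lsc_on_def by blast
    then show ?thesis unfolding eventually_at_topological using that(2) by metis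
  qed
  then obtain T where T: "\<And>y. y \<in> S \<Longrightarrow> r < f y \<Longrightarrow> open (T y) \<and> y \<in> T y \<and> (\<forall>b\<in>T y. b \<in> S \<longrightarrow> r < f b)"
    by metis
  define V where "V = (\<Union>y\<in>{y\<in>S. r < f y}. T y)"
  have "open V" unfolding V_def using T by blast
  moreover have "{y\<in>S. f y \<le> r} = S \<inter> - V"
  proof (intro set_eqI iffI)
    fix y assume y: "y \<in> {y\<in>S. f y \<le> r}"
    have "y \<notin> T z" if "z \<in> S" "r < f z" for z
      using T[OF that] y by auto
    then have "y \<notin> V" unfolding V_def by blast
    with y show "y \<in> S \<inter> - V" by auto
  next
    fix y assume y: "y \<in> S \<inter> - V"
    then have "\<not> r < f y" unfolding V_def using T by blast
    with y show "y \<in> {y\<in>S. f y \<le> r}" by auto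
  qed
  ultimately show ?thesis using assms(2) by (simp add: compact_Int_closed closed_Compl)
qed

text \<open>The sublevel sets at attained values are compact and have the finite intersection
  property; any point common to all of them is a minimiser.\<close>

lemma lsc_on_attains_inf:
  fixes f :: "'a::t2_space \<Rightarrow> real"
  assumes "lsc_on S f" "compact S" "S \<noteq> {}"
  obtains y where "y \<in> S" "\<And>z. z \<in> S \<Longrightarrow> f y \<le> f z"
proof -
  let ?F = "(\<lambda>z. {y\<in>S. f y \<le> f z}) ` S"
  have "S \<inter> \<Inter>?F \<noteq> {}"
  proof (rule compact_imp_fip[OF assms(2)])
    fix T assume "T \<in> ?F"
    then show "closed T" using lsc_on_sublevel_compact[OF assms(1,2)] compact_imp_closed by blast
  next
    fix F' assume F': "finite F'" "F' \<subseteq> ?F"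
    then obtain Z where Z: "finite Z" "Z \<subseteq> S" "F' = (\<lambda>z. {y\<in>S. f y \<le> f z}) ` Z"
      by (meson finite_subset_image)
    show "S \<inter> \<Inter>F' \<noteq> {}"
    proof (cases "Z = {}")
      case True
      then show ?thesis using Z assms(3) by simp
    next
      case False
      then have "Min (f ` Z) \<in> f ` Z" using Z(1) by (intro Min_in) auto
      then obtain z where z: "z \<in> Z" "f z = Min (f ` Z)" by force
      then have "z \<in> S \<inter> \<Inter>F'" using Z by auto
      then show ?thesis by blast
    qed
  qed
  then show ?thesis using that by blast
qed

definition argmin_sections :: "('x \<times> 'a) set \<Rightarrow> ('x \<times> 'a \<Rightarrow> real) \<Rightarrow> ('x \<times> 'a) set" where
  "argmin_sections M f = {p\<in>M. \<forall>y. (fst p, y) \<in> M \<longrightarrow> f p \<le> f (fst p, y)}"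

text \<open>This class is stable under \<open>argmin_sections\<close> for suitable functions, so
  minimisations can be iterated. The projection condition encodes that the sections are nonempty
  exactly over \<open>X\<close>.\<close>

definition compact_correspondence ::
  "'x::{complete_space, second_countable_topology} set \<Rightarrow>
   ('x \<times> 'a::{complete_space, second_countable_topology}) set \<Rightarrow> bool" where
  "compact_correspondence X M \<longleftrightarrow> X \<in> sets borel \<and> M \<in> sets borel \<and> fst ` M = X \<and> (\<forall>x. compact (M `` {x}))"

text \<open>A sublevel set of the minimum \<open>m\<close> is the projection of a sublevel set of
  \<open>f\<close>, which is Borel with compact sections; here the projection theorem enters. The
  minimisers then form the Borel set where \<open>f\<close> equals \<open>m\<close>.\<close>

lemma compact_correspondence_argmin:
  assumes M: "compact_correspondence X M"
    and f: "f \<in> borel_measurable (bor M)"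
    and lsc: "\<And>x. x \<in> X \<Longrightarrow> lsc_on (M `` {x}) (\<lambda>y. f (x, y))"
  shows "compact_correspondence X (argmin_sections M f)"
    and "\<And>m. (\<And>x y. (x, y) \<in> argmin_sections M f \<Longrightarrow> f (x, y) = m x) \<Longrightarrow> m \<in> borel_measurable (bor X)"
proof -
  have X: "X \<in> sets borel" and Mb: "M \<in> sets borel" and fstM: "fst ` M = X"
    and cpt: "\<And>x. compact (M `` {x})"
    using M unfolding compact_correspondence_def by auto
  have ex: "\<exists>y. (x, y) \<in> argmin_sections M f" if "x \<in> X" for x
  proof -
    have "lsc_on (M `` {x}) (\<lambda>y. f (x, y))" "M `` {x} \<noteq> {}" using lsc that fstM by force+
    then obtain y where "y \<in> M `` {x}" "\<And>z. z \<in> M `` {x} \<Longrightarrow> f (x, y) \<le> f (x, z)"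
      using lsc_on_attains_inf[OF _ cpt] by blast
    then show ?thesis unfolding argmin_sections_def by auto
  qed
  \<comment> \<open>Compactness is wanted at every x, and outside \<open>X\<close> the sections are
    empty.\<close>
  have lsc': "compact {y \<in> M `` {x}. f (x, y) \<le> r}" for x r
  proof (cases "x \<in> X")
    case True
    then show ?thesis by (intro lsc_on_sublevel_compact lsc cpt)
  next
    case False
    then have "M `` {x} = {}" using fstM by force
    then show ?thesis by simp
  qed
  show meas: "m \<in> borel_measurable (bor X)"
    if m: "\<And>x y. (x, y) \<in> argmin_sections M f \<Longrightarrow> f (x, y) = m x" for m
  proof (rule borel_measurableI_le)
    fix r
    have "{p \<in> space (bor M). f p \<le> r} \<in> sets (bor M)"
      using f by measurable
    then have "{p \<in> M. f p \<le> r} \<in> sets borel"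
      using Mb by (simp add: space_restrict_space sets_restrict_space_iff)
    moreover have "compact ({p \<in> M. f p \<le> r} `` {x})" for x
    proof -
      have "{p \<in> M. f p \<le> r} `` {x} = {y \<in> M `` {x}. f (x, y) \<le> r}" by auto
      then show ?thesis using lsc' by simp
    qed
    ultimately have "fst ` {p \<in> M. f p \<le> r} \<in> sets borel"
      by (rule projection_borel_compact_sections)
    also have "fst ` {p \<in> M. f p \<le> r} = {x \<in> X. m x \<le> r}"
    proof (intro set_eqI iffI)
      fix x assume "x \<in> fst ` {p \<in> M. f p \<le> r}"
      then obtain y where y: "(x, y) \<in> M" "f (x, y) \<le> r" by auto
      then have "x \<in> X" using fstM by force
      then obtain z where z: "(x, z) \<in> argmin_sections M f" using ex by blast
      then have "f (x, z) \<le> f (x, y)" using y(1) unfolding argmin_sections_def by auto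
      with y m[OF z] \<open>x \<in> X\<close> show "x \<in> {x \<in> X. m x \<le> r}" by simp
    next
      fix x assume x: "x \<in> {x \<in> X. m x \<le> r}"
      then obtain z where z: "(x, z) \<in> argmin_sections M f" using ex by blast
      then have "(x, z) \<in> M" "f (x, z) \<le> r" using m[OF z] x unfolding argmin_sections_def by auto
      then show "x \<in> fst ` {p \<in> M. f p \<le> r}" by force
    qed
    finally show "{x \<in> space (bor X). m x \<le> r} \<in> sets (bor X)"
      using X by (simp add: space_restrict_space sets_restrict_space_iff)
  qed
  \<comment> \<open>The choice is harmless: \<open>f\<close> is constant on the minimisers of one
    section.\<close>
  define m where "m x = f (x, SOME y. (x, y) \<in> argmin_sections M f)" for x
  have mI: "f (x, y) = m x" if "(x, y) \<in> argmin_sections M f" for x y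
  proof -
    have "(x, SOME y. (x, y) \<in> argmin_sections M f) \<in> argmin_sections M f"
      using that by (rule someI)
    then show ?thesis using that unfolding m_def argmin_sections_def by (auto intro: antisym)
  qed
  have le: "m x \<le> f (x, y)" if "(x, y) \<in> M" for x y
  proof -
    have "x \<in> X" using that fstM by force
    then obtain z where z: "(x, z) \<in> argmin_sections M f" using ex by blast
    then show ?thesis using mI[OF z] that unfolding argmin_sections_def by auto
  qed
  have eq: "argmin_sections M f = {p \<in> M. f p = m (fst p)}"
  proof (intro set_eqI iffI)
    fix p assume "p \<in> argmin_sections M f"
    then show "p \<in> {p \<in> M. f p = m (fst p)}"
      using mI[of "fst p" "snd p"] unfolding argmin_sections_def by simp
  qed (use le in \<open>auto simp: argmin_sections_def\<close>)
  have "fst \<in> measurable (bor M) (bor X)"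
  proof (rule measurable_restrict_space2)
    show "fst \<in> space (bor M) \<rightarrow> X" using fstM by (auto simp: space_restrict_space)
    show "fst \<in> borel_measurable (bor M)"
      by (intro measurable_restrict_space1 borel_measurable_continuous_onI continuous_intros)
  qed
  then have [measurable]: "(\<lambda>p. m (fst p)) \<in> borel_measurable (bor M)"
    using meas[OF mI] by (rule measurable_compose)
  note f [measurable]
  have "{p \<in> space (bor M). f p = m (fst p)} \<in> sets (bor M)" by measurable
  then have "argmin_sections M f \<in> sets borel"
    unfolding eq using Mb by (simp add: space_restrict_space sets_restrict_space_iff)
  moreover have "compact (argmin_sections M f `` {x})" for x
  proof -
    have "argmin_sections M f `` {x} = {y \<in> M `` {x}. f (x, y) \<le> m x}"
      unfolding eq using le by (auto intro: antisym)
    then show ?thesis using lsc' by simp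
  qed
  moreover have "fst ` argmin_sections M f = X"
  proof
    show "fst ` argmin_sections M f \<subseteq> X" unfolding argmin_sections_def using fstM by blast
    show "X \<subseteq> fst ` argmin_sections M f" using ex by (force intro: image_eqI)
  qed
  ultimately show "compact_correspondence X (argmin_sections M f)"
    using X unfolding compact_correspondence_def by blast
qed

lemma lsc_on_continuous_on:
  assumes "continuous_on S f"
  shows "lsc_on S f"
  using assms unfolding lsc_on_def continuous_on_def by (auto intro: order_tendstoD)

text \<open>A selector is found by minimising the distances to the points of a dense sequence one
  after another: the points surviving all minimisations are determined by their distances.\<close>

theorem compact_correspondence_selector:
  fixes M :: "('x::{complete_space, second_countable_topology} \<times>
    'a::{complete_space, second_countable_topology}) set"
  assumes M: "compact_correspondence X M"
  obtains g where "g \<in> borel_measurable (bor X)" "\<And>x. x \<in> X \<Longrightarrow> (x, g x) \<in> M"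
proof -
  obtain d :: "nat \<Rightarrow> 'a" where d: "\<And>x e. e > 0 \<Longrightarrow> \<exists>n. dist x (d n) < e"
    using dense_sequence_exists by blast
  define N where "N = rec_nat M (\<lambda>k N. argmin_sections N (\<lambda>p. dist (snd p) (d k)))"
  have N0: "N 0 = M" and NS: "N (Suc k) = argmin_sections (N k) (\<lambda>p. dist (snd p) (d k))" for k
    unfolding N_def by simp_all
  have meas: "(\<lambda>p. dist (snd p) (d k)) \<in> borel_measurable (bor T)" for k and T :: "('x \<times> 'a) set"
    by (intro measurable_restrict_space1 borel_measurable_continuous_onI continuous_intros)
  have lsc: "lsc_on T (\<lambda>y. dist (snd (x, y)) (d k))" for k T and x :: 'x
    by (intro lsc_on_continuous_on continuous_intros)
  have N: "compact_correspondence X (N k)" for k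
  proof (induction k)
    case (Suc k)
    show ?case unfolding NS by (rule compact_correspondence_argmin(1)[OF Suc meas lsc])
  qed (simp add: N0 M)
  \<comment> \<open>The sections of the \<open>N k\<close> at x are nonempty, compact and
    decreasing.\<close>
  have ne: "(\<Inter>k. N k `` {x}) \<noteq> {}" if "x \<in> X" for x
  proof -
    have "N (Suc k) \<subseteq> N k" for k unfolding NS argmin_sections_def by auto
    then have dec: "N n \<subseteq> N m" if "m \<le> n" for m n using that by (rule lift_Suc_antimono_le)
    have cpt: "compact (N k `` {x})" for k using N unfolding compact_correspondence_def by blast
    have "N 0 `` {x} \<inter> (\<Inter>k\<in>UNIV. N k `` {x}) \<noteq> {}"
    proof (rule compact_imp_fip_image[OF cpt])
      show "closed (N k `` {x})" for k using cpt by (rule compact_imp_closed)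
      fix I :: "nat set" assume "finite I"
      then obtain n where n: "\<forall>k\<in>I. k \<le> n" unfolding finite_nat_set_iff_bounded_le ..
      have "x \<in> fst ` N n" using N[of n] that unfolding compact_correspondence_def by simp
      then obtain y where "(x, y) \<in> N n" by auto
      then have "(x, y) \<in> N k" if "k \<le> n" for k using dec[OF that] by blast
      then have "y \<in> N 0 `` {x} \<inter> (\<Inter>k\<in>I. N k `` {x})" using n by simp
      then show "N 0 `` {x} \<inter> (\<Inter>k\<in>I. N k `` {x}) \<noteq> {}" by blast
    qed
    then show ?thesis by blast
  qed
  define g where "g x = (SOME y. y \<in> (\<Inter>k. N k `` {x}))" for x
  have "g x \<in> (\<Inter>k. N k `` {x})" if "x \<in> X" for x
    unfolding g_def using ne[OF that] by (rule someI_ex[OF ex_in_conv[THEN iffD2]])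
  then have g: "(x, g x) \<in> N k" if "x \<in> X" for x k using that by blast
  \<comment> \<open>Although \<open>g\<close> is an arbitrary choice, its distance to
    \<open>d k\<close> is the minimum over the section of \<open>N k\<close>, which is measurable in
    x.\<close>
  have dg: "(\<lambda>x. dist (g x) (d k)) \<in> borel_measurable (bor X)" for k
  proof (rule compact_correspondence_argmin(2)[OF N meas lsc])
    fix x y assume "(x, y) \<in> argmin_sections (N k) (\<lambda>p. dist (snd p) (d k))"
    moreover from this have "x \<in> X"
      using N[of k] unfolding compact_correspondence_def argmin_sections_def by force
    then have "(x, g x) \<in> argmin_sections (N k) (\<lambda>p. dist (snd p) (d k))"
      using g[of x "Suc k"] unfolding NS by simp
    ultimately show "dist (snd (x, y)) (d k) = dist (g x) (d k)"
      unfolding argmin_sections_def by (auto intro: antisym)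
  qed
  have "g \<in> borel_measurable (bor X)" by (rule measurable_from_distances[OF d dg])
  then show ?thesis using g[of _ 0] N0 that by simp
qed

section \<open>Discounted risk\<close>

text \<open>Telescoping against a geometric series. Applied at each state separately, with a
  multiple of \<open>w x\<close> as \<open>C\<close>, it takes the place of completeness of the
  weighted space.\<close>

lemma geometric_increments_limit:
  fixes a :: "nat \<Rightarrow> real"
  assumes inc: "\<And>n. \<bar>a (Suc n) - a n\<bar> \<le> C * \<gamma> ^ n" and \<gamma>: "0 \<le> \<gamma>" "\<gamma> < 1"
  obtains l where "a \<longlonglongrightarrow> l" "\<And>n. \<bar>l - a n\<bar> \<le> C / (1 - \<gamma>) * \<gamma> ^ n"
proof -
  have part: "\<bar>a (n + k) - a n\<bar> \<le> C / (1 - \<gamma>) * (\<gamma> ^ n - \<gamma> ^ (n + k))" for n k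
  proof (induction k)
    case (Suc k)
    have "C / (1 - \<gamma>) * (\<gamma> ^ n - \<gamma> ^ (n + k)) + C * \<gamma> ^ (n + k) = C / (1 - \<gamma>) * (\<gamma> ^ n - \<gamma> ^ (n + Suc k))"
      using \<gamma> by (simp add: field_simps)
    then show ?case using Suc inc[of "n + k"] by simp
  qed simp
  have "0 \<le> C" using inc[of 0] by simp
  have "summable (\<lambda>n. C * \<gamma> ^ n)" using \<gamma> by (intro summable_mult summable_geometric) simp
  then have "summable (\<lambda>n. a (Suc n) - a n)"
    by (rule summable_comparison_test'[where N = 0]) (use inc in simp)
  then have "convergent (\<lambda>n. (\<Sum>k<n. a (Suc k) - a k))" by (simp add: summable_iff_convergent)
  then obtain l where "(\<lambda>n. a n - a 0) \<longlonglongrightarrow> l"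
    unfolding sum_lessThan_telescope convergent_def by blast
  from tendsto_add[OF this tendsto_const[of "a 0"]] have lim: "a \<longlonglongrightarrow> l + a 0" by simp
  show ?thesis
  proof (rule that[OF lim])
    fix n
    have "(\<lambda>k. a (k + n)) \<longlonglongrightarrow> l + a 0" using lim by (rule LIMSEQ_ignore_initial_segment)
    then have "(\<lambda>k. \<bar>a (k + n) - a n\<bar>) \<longlonglongrightarrow> \<bar>l + a 0 - a n\<bar>" by (intro tendsto_intros)
    moreover have "\<bar>a (k + n) - a n\<bar> \<le> C / (1 - \<gamma>) * \<gamma> ^ n" for k
    proof -
      have "C / (1 - \<gamma>) * (\<gamma> ^ n - \<gamma> ^ (n + k)) \<le> C / (1 - \<gamma>) * \<gamma> ^ n"
        using \<gamma> \<open>0 \<le> C\<close> by (intro mult_left_mono) auto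
      then show ?thesis using part[of n k] by (simp add: add.commute)
    qed
    ultimately show "\<bar>l + a 0 - a n\<bar> \<le> C / (1 - \<gamma>) * \<gamma> ^ n" by (intro LIMSEQ_le_const2) auto
  qed
qed

text \<open>Pushing \<open>L x\<close> forward under y to (x, y) gives a kernel into the product,
  against which the fixed function of two variables is integrated.\<close>

lemma integral_measurable_kernel:
  fixes f :: "'a \<Rightarrow> 'b \<Rightarrow> real"
  assumes f [measurable]: "(\<lambda>(x, y). f x y) \<in> borel_measurable (M \<Otimes>\<^sub>M N)"
    and L [measurable]: "L \<in> measurable M (subprob_algebra N)"
  shows "(\<lambda>x. LINT y|L x. f x y) \<in> borel_measurable M"
proof -
  note measurable_distr2[measurable]
  have "(\<lambda>x. LINT p|distr (L x) (M \<Otimes>\<^sub>M N) (\<lambda>y. (x, y)). (\<lambda>(x, y). f x y) p) \<in> borel_measurable M"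
    by measurable
  moreover have "(LINT p|distr (L x) (M \<Otimes>\<^sub>M N) (\<lambda>y. (x, y)). (\<lambda>(x, y). f x y) p) = (LINT y|L x. f x y)"
    if "x \<in> space M" for x
  proof -
    have "sets (L x) = sets N" using subprob_measurableD(2)[OF L that] .
    then have "(\<lambda>y. (x, y)) \<in> measurable (L x) (M \<Otimes>\<^sub>M N)"
      using measurable_Pair1'[OF that] measurable_cong_sets by blast
    then show ?thesis by (subst integral_distr[OF _ f]) simp_all
  qed
  ultimately show ?thesis by (simp cong: measurable_cong)
qed

lemma abs_diff_leD:
  fixes a b e :: real
  assumes "\<bar>a - b\<bar> \<le> e"
  shows "a \<le> b + e" "b \<le> a + e"
  using assms by auto

text \<open>The summand 0 lets these facts match the one-sided premise of \<open>R_lipschitz\<close>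
  when one of the two functions is zero.\<close>

lemma abs_leD:
  fixes a e :: real
  assumes "\<bar>a\<bar> \<le> e"
  shows "a \<le> 0 + e" "0 \<le> a + e"
  using assms by auto

section \<open>Contraction estimates and greedy actions\<close>

locale bounded_risk_mcp = markov_control_process X A As Q c
  for X :: "'x::polish_space set" and A :: "'a::polish_space set" and As Q and c :: "'x \<times> 'a \<Rightarrow> real" +
  fixes w :: "'x \<Rightarrow> real" and R :: "('x \<Rightarrow> real) \<Rightarrow> 'x \<times> 'a \<Rightarrow> real" and \<alpha> cbar wbar :: real
  assumes w_meas: "w \<in> borel_measurable (bor X)"
    and w_ge_1: "\<And>x. x \<in> X \<Longrightarrow> 1 \<le> w x"
    and risk: "risk_map X As w R"
    and \<alpha>: "0 \<le> \<alpha>" and cbar: "0 \<le> cbar" and wbar: "0 \<le> wbar" and \<alpha>_wbar: "\<alpha> * wbar < 1"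
    and c_bound: "\<And>x a. x \<in> X \<Longrightarrow> a \<in> As x \<Longrightarrow> \<bar>c (x, a)\<bar> \<le> cbar * w x"
    and R_bound: "\<And>x a. x \<in> X \<Longrightarrow> a \<in> As x \<Longrightarrow> Rsharp_bar X w R w (x, a) \<le> ereal (wbar * w x)"
    and c_lsc: "\<And>x. x \<in> X \<Longrightarrow> lsc_on (As x) (\<lambda>a. c (x, a))"
    and As_compact: "\<And>x. x \<in> X \<Longrightarrow> compact (As x)"
    and R_cont: "\<And>x u. x \<in> X \<Longrightarrow> u \<in> Bw X w \<Longrightarrow> continuous_on (As x) (\<lambda>a. R u (x, a))"
begin

abbreviation "\<B> \<equiv> Bw X w"
abbreviation "\<gamma> \<equiv> \<alpha> * wbar"
abbreviation "K \<equiv> Sigma X As"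

definition H :: "('x \<Rightarrow> real) \<Rightarrow> 'x \<times> 'a \<Rightarrow> real" where
  "H v p = c p + \<alpha> * R v p"

lemma \<gamma>_nonneg: "0 \<le> \<gamma>"
  using \<alpha> wbar by simp

lemma w_nonneg: "x \<in> X \<Longrightarrow> 0 \<le> w x"
  using w_ge_1[of x] by simp

lemma BwI:
  assumes "u \<in> borel_measurable (bor X)" "\<And>x. x \<in> X \<Longrightarrow> \<bar>u x\<bar> \<le> b * w x"
  shows "u \<in> \<B>"
proof -
  have "\<bar>u x\<bar> / w x \<le> b" if "x \<in> X" for x
    using assms(2)[OF that] w_ge_1[OF that] by (simp add: divide_le_eq)
  then show ?thesis using assms(1) unfolding Bw_def by (auto intro: bdd_aboveI2[where M = b])
qed

lemma BwE:
  assumes "u \<in> \<B>"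
  obtains b where "0 \<le> b" "\<And>x. x \<in> X \<Longrightarrow> \<bar>u x\<bar> \<le> b * w x"
proof -
  obtain b where b: "\<And>x. x \<in> X \<Longrightarrow> \<bar>u x\<bar> / w x \<le> b"
    using assms unfolding Bw_def bdd_above_def by auto
  \<comment> \<open>The bound \<open>b\<close> can be negative only if \<open>X\<close> is empty;
    the maximum makes it nonnegative in every case.\<close>
  have "\<bar>u x\<bar> \<le> max b 0 * w x" if "x \<in> X" for x
  proof -
    have "\<bar>u x\<bar> \<le> b * w x" using b[OF that] w_ge_1[OF that] by (simp add: divide_le_eq)
    also have "\<dots> \<le> max b 0 * w x" using w_nonneg[OF that] by (intro mult_right_mono) auto
    finally show ?thesis .
  qed
  then show ?thesis using that[of "max b 0"] by simp
qed

lemma Bw_measurable: "u \<in> \<B> \<Longrightarrow> u \<in> borel_measurable (bor X)"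
  unfolding Bw_def by blast

lemma Bw_zero: "(\<lambda>x. 0) \<in> \<B>"
  by (rule BwI[where b = 0]) auto

lemma Bw_scale_w_add:
  assumes "u \<in> \<B>"
  shows "(\<lambda>y. d * w y + u y) \<in> \<B>"
proof -
  obtain b where b: "0 \<le> b" "\<And>x. x \<in> X \<Longrightarrow> \<bar>u x\<bar> \<le> b * w x" using assms by (rule BwE) blast
  show ?thesis
  proof (rule BwI[where b = "\<bar>d\<bar> + b"])
    show "(\<lambda>y. d * w y + u y) \<in> borel_measurable (bor X)"
      using w_meas Bw_measurable[OF assms] by measurable
    fix x assume x: "x \<in> X"
    have "\<bar>d * w x + u x\<bar> \<le> \<bar>d\<bar> * w x + \<bar>u x\<bar>"
      using w_nonneg[OF x] by (metis abs_mult abs_of_nonneg abs_triangle_ineq)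
    then show "\<bar>d * w x + u x\<bar> \<le> (\<bar>d\<bar> + b) * w x" using b(2)[OF x] by (simp add: distrib_right)
  qed
qed

lemma R_mono:
  assumes "p \<in> K" "u \<in> \<B>" "v \<in> \<B>" "\<And>y. y \<in> X \<Longrightarrow> u y \<le> v y"
  shows "R u p \<le> R v p"
  using risk assms unfolding risk_map_def real_risk_measure_def by blast

lemma R_zero: "p \<in> K \<Longrightarrow> R (\<lambda>x. 0) p = 0"
  using risk unfolding risk_map_def real_risk_measure_def by blast

text \<open>Monotonicity replaces \<open>u\<close> by \<open>v + d w\<close>, and
  \<open>Rsharp\<close> at \<open>d w\<close> bounds the resulting increment over
  \<open>R v\<close>. The scalar \<open>d\<close> is one of those in the supremum
  \<open>Rsharp_bar\<close>, which gives the factor \<open>d * wbar * w x\<close>.\<close>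

lemma R_lipschitz:
  assumes x: "x \<in> X" and a: "a \<in> As x" and u: "u \<in> \<B>" and v: "v \<in> \<B>" and d: "0 \<le> d"
    and le: "\<And>y. y \<in> X \<Longrightarrow> u y \<le> v y + d * w y"
  shows "R u (x, a) \<le> R v (x, a) + wbar * (d * w x)"
\<comment> \<open>The supremum in \<open>Rsharp_bar\<close> leaves out the scalar 0, so this case
  rests on monotonicity alone.\<close>
proof (cases "d = 0")
  case True
  then show ?thesis using R_mono[of "(x, a)" u v] assms by simp
next
  case False
  then have "d > 0" using d by simp
  have "R u (x, a) \<le> R (\<lambda>y. d * w y + v y) (x, a)"
    using le x a by (intro R_mono u Bw_scale_w_add v) (auto simp: add.commute)
  moreover have "R (\<lambda>y. d * w y + v y) (x, a) - R v (x, a) \<le> d * (wbar * w x)"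
  proof -
    have "ereal (R (\<lambda>y. d * w y + v y) (x, a) - R v (x, a)) \<le> Rsharp X w R (\<lambda>y. d * w y) (x, a)"
      unfolding Rsharp_def using v by (rule SUP_upper)
    moreover have "Rsharp X w R (\<lambda>y. d * w y) (x, a) / ereal d \<le> Rsharp_bar X w R w (x, a)"
      unfolding Rsharp_bar_def using False by (intro SUP_upper) simp
    then have "Rsharp X w R (\<lambda>y. d * w y) (x, a) / ereal d \<le> ereal (wbar * w x)"
      using R_bound[OF x a] by (rule order_trans)
    then have "Rsharp X w R (\<lambda>y. d * w y) (x, a) \<le> ereal d * ereal (wbar * w x)"
      using \<open>d > 0\<close> by (subst (asm) ereal_divide_le_pos) auto
    ultimately show ?thesis by (metis ereal_less_eq(3) order_trans times_ereal.simps(1))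
  qed
  ultimately show ?thesis by (simp add: algebra_simps)
qed

lemma H_lipschitz:
  assumes "x \<in> X" "a \<in> As x" "u \<in> \<B>" "v \<in> \<B>" "0 \<le> d" "\<And>y. y \<in> X \<Longrightarrow> u y \<le> v y + d * w y"
  shows "H u (x, a) \<le> H v (x, a) + \<gamma> * (d * w x)"
  using mult_left_mono[OF R_lipschitz[OF assms] \<alpha>] unfolding H_def by (simp add: algebra_simps)

lemma R_measurable: "v \<in> \<B> \<Longrightarrow> R v \<in> borel_measurable (bor K)"
  using risk unfolding risk_map_def by blast

lemma H_measurable: "v \<in> \<B> \<Longrightarrow> H v \<in> borel_measurable (bor K)"
  unfolding H_def using measurable_c R_measurable by measurable

lemma R_abs_le:
  assumes "v \<in> \<B>" "0 \<le> b" "\<And>y. y \<in> X \<Longrightarrow> \<bar>v y\<bar> \<le> b * w y" "x \<in> X" "a \<in> As x"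
  shows "\<bar>R v (x, a)\<bar> \<le> wbar * (b * w x)"
proof -
  have "R v (x, a) \<le> R (\<lambda>x. 0) (x, a) + wbar * (b * w x)"
    by (rule R_lipschitz[OF assms(4,5,1) Bw_zero assms(2) abs_leD(1)[OF assms(3)]])
  moreover have "R (\<lambda>x. 0) (x, a) \<le> R v (x, a) + wbar * (b * w x)"
    by (rule R_lipschitz[OF assms(4,5) Bw_zero assms(1,2) abs_leD(2)[OF assms(3)]])
  ultimately show ?thesis using R_zero[of "(x, a)"] assms by auto
qed

lemma H_abs_le:
  assumes "v \<in> \<B>" "0 \<le> b" "\<And>y. y \<in> X \<Longrightarrow> \<bar>v y\<bar> \<le> b * w y" "x \<in> X" "a \<in> As x"
  shows "\<bar>H v (x, a)\<bar> \<le> (cbar + \<gamma> * b) * w x"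
proof -
  have "\<bar>H v (x, a)\<bar> \<le> \<bar>c (x, a)\<bar> + \<alpha> * \<bar>R v (x, a)\<bar>"
    unfolding H_def using \<alpha> by (metis abs_mult abs_of_nonneg abs_triangle_ineq)
  also have "\<dots> \<le> cbar * w x + \<alpha> * (wbar * (b * w x))"
    using \<alpha> by (intro add_mono c_bound mult_left_mono R_abs_le assms)
  finally show ?thesis by (simp add: algebra_simps)
qed

lemma compact_correspondence_K: "compact_correspondence X K"
proof -
  have "fst ` K = X" using As by (force simp: image_iff)
  moreover have "compact (K `` {x})" for x
    using As_compact by (cases "x \<in> X") (auto simp: Sigma_Image)
  ultimately show ?thesis using borel_X borel_K unfolding compact_correspondence_def by blast
qed

lemma H_lsc:
  assumes x: "x \<in> X" and v: "v \<in> \<B>"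
  shows "lsc_on (As x) (\<lambda>a. H v (x, a))"
  unfolding lsc_on_def
proof (intro ballI allI impI)
  fix a y assume a: "a \<in> As x" and y: "y < H v (x, a)"
  \<comment> \<open>Half of the gap is allotted to each summand: semicontinuity controls the cost,
    continuity the risk term.\<close>
  define e where "e = (H v (x, a) - y) / 2"
  have "e > 0" using y unfolding e_def by simp
  then have "\<forall>\<^sub>F b in at a within As x. c (x, a) - e < c (x, b)"
    using c_lsc[OF x] a unfolding lsc_on_def by simp
  moreover have "continuous_on (As x) (\<lambda>a. \<alpha> * R v (x, a))"
    by (intro continuous_intros R_cont x v)
  then have "((\<lambda>a. \<alpha> * R v (x, a)) \<longlongrightarrow> \<alpha> * R v (x, a)) (at a within As x)"
    using a unfolding continuous_on_def by blast
  then have "\<forall>\<^sub>F b in at a within As x. \<alpha> * R v (x, a) - e < \<alpha> * R v (x, b)"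
    using \<open>e > 0\<close> by (intro order_tendstoD) auto
  ultimately show "\<forall>\<^sub>F b in at a within As x. y < H v (x, b)"
    by eventually_elim (auto simp: H_def e_def field_simps)
qed

definition greedy :: "('x \<Rightarrow> real) \<Rightarrow> ('x \<Rightarrow> 'a) \<Rightarrow> bool" where
  "greedy v g \<longleftrightarrow> g \<in> measurable (bor X) (bor A) \<and>
     (\<forall>x\<in>X. g x \<in> As x \<and> (\<forall>a\<in>As x. H v (x, g x) \<le> H v (x, a)))"

lemma greedyD:
  assumes "greedy v g" "x \<in> X"
  shows "g x \<in> As x" "\<And>a. a \<in> As x \<Longrightarrow> H v (x, g x) \<le> H v (x, a)"
  using assms by (simp_all add: greedy_def)

text \<open>A measurable selector of the minimiser correspondence of \<open>H v\<close> is a greedy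
  one.\<close>

lemma greedy_exists:
  assumes v: "v \<in> \<B>"
  shows "\<exists>g. greedy v g"
proof -
  have KX: "K `` {x} = As x" if "x \<in> X" for x using that by auto
  have "compact_correspondence X (argmin_sections K (H v))"
    by (rule compact_correspondence_argmin(1)[OF compact_correspondence_K H_measurable[OF v]])
      (simp add: KX H_lsc v)
  then obtain g where g: "g \<in> borel_measurable (bor X)"
    "\<And>x. x \<in> X \<Longrightarrow> (x, g x) \<in> argmin_sections K (H v)"
    by (rule compact_correspondence_selector) blast
  have g': "g x \<in> As x \<and> (\<forall>a\<in>As x. H v (x, g x) \<le> H v (x, a))" if "x \<in> X" for x
    using g(2)[OF that] that unfolding argmin_sections_def by auto
  have "g \<in> measurable (bor X) (bor A)"
    using g(1) g' As by (intro measurable_restrict_space2) (auto simp: space_restrict_space)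
  then show ?thesis using g' unfolding greedy_def by blast
qed

section \<open>Averages over randomised policies\<close>

definition avg :: "('x \<times> 'a \<Rightarrow> real) \<Rightarrow> ('x \<Rightarrow> 'a measure) \<Rightarrow> 'x \<Rightarrow> real" where
  "avg F \<pi> x = (LINT a:As x|\<pi> x. F (x, a))"

lemma DeltaD:
  assumes "\<pi> \<in> Delta X A As" "x \<in> X"
  shows "prob_space (\<pi> x)" "sets (\<pi> x) = sets (bor A)" "measure (\<pi> x) (As x) = 1" "As x \<in> sets (\<pi> x)"
proof -
  have "\<pi> x \<in> space (prob_algebra (bor A))"
    using assms measurable_space[of \<pi> "bor X" "prob_algebra (bor A)" x]
    unfolding Delta_def by (simp add: space_restrict_space)
  then show "prob_space (\<pi> x)" and s: "sets (\<pi> x) = sets (bor A)"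
    by (auto simp: space_prob_algebra)
  show "measure (\<pi> x) (As x) = 1" using assms unfolding Delta_def by blast
  show "As x \<in> sets (\<pi> x)" unfolding s using As[OF assms(2)] borel_A by (simp add: sets_restrict_space_iff)
qed

text \<open>Extension by zero from \<open>K\<close> to the whole product makes integration against a
  kernel applicable. Second countability identifies the product of the Borel sigma-algebras with the
  Borel sigma-algebra of the product.\<close>

lemma joint_measurable:
  fixes F :: "'x \<times> 'a \<Rightarrow> real"
  assumes F: "F \<in> borel_measurable (bor K)"
  shows "(\<lambda>(x, a). indicator (As x) a *\<^sub>R F (x, a)) \<in> borel_measurable (bor X \<Otimes>\<^sub>M bor A)"
proof -
  have "(\<lambda>p. indicator K p *\<^sub>R F p) \<in> borel_measurable borel"
    using F borel_K borel_measurable_restrict_space_iff[of K borel F] by simp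
  moreover have "(\<lambda>p. (fst p, snd p)) \<in> measurable (bor X \<Otimes>\<^sub>M bor A) (borel :: ('x \<times> 'a) measure)"
    unfolding borel_prod[symmetric]
  proof (rule measurable_Pair)
    show "fst \<in> borel_measurable (bor X \<Otimes>\<^sub>M bor A)"
      by (rule measurable_compose[OF measurable_fst]) (simp add: measurable_restrict_space1)
    show "snd \<in> borel_measurable (bor X \<Otimes>\<^sub>M bor A)"
      by (rule measurable_compose[OF measurable_snd]) (simp add: measurable_restrict_space1)
  qed
  ultimately have "(\<lambda>p. indicator K (fst p, snd p) *\<^sub>R F (fst p, snd p)) \<in> borel_measurable (bor X \<Otimes>\<^sub>M bor A)"
    by (rule measurable_compose[rotated])
  then show ?thesis
    by (rule measurable_cong[THEN iffD1, rotated])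
      (auto simp: space_pair_measure space_restrict_space indicator_def)
qed

lemma avg_measurable:
  assumes F: "F \<in> borel_measurable (bor K)" and \<pi>: "\<pi> \<in> Delta X A As"
  shows "avg F \<pi> \<in> borel_measurable (bor X)"
proof -
  have "\<pi> \<in> measurable (bor X) (subprob_algebra (bor A))"
    using \<pi> unfolding Delta_def by (auto intro: measurable_prob_algebraD)
  from integral_measurable_kernel[OF joint_measurable[OF F] this]
  show ?thesis unfolding avg_def[abs_def] set_lebesgue_integral_def .
qed

lemma section_integrable:
  fixes F :: "'x \<times> 'a \<Rightarrow> real"
  assumes F: "F \<in> borel_measurable (bor K)" and \<pi>: "\<pi> \<in> Delta X A As" and x: "x \<in> X"
    and b: "\<And>a. a \<in> As x \<Longrightarrow> \<bar>F (x, a)\<bar> \<le> b"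
  shows "set_integrable (\<pi> x) (As x) (\<lambda>a. F (x, a))"
proof -
  interpret prob_space "\<pi> x" by (rule DeltaD(1)[OF \<pi> x])
  obtain a where "a \<in> As x" using As[OF x] by blast
  then have "0 \<le> b" using b[of a] by linarith
  have "(\<lambda>a. indicator (As x) a *\<^sub>R F (x, a)) \<in> borel_measurable (bor A)"
    using measurable_compose[OF measurable_Pair1'[of x "bor X" "bor A"] joint_measurable[OF F]] x
    by (simp add: space_restrict_space)
  then have "(\<lambda>a. indicator (As x) a *\<^sub>R F (x, a)) \<in> borel_measurable (\<pi> x)"
    using measurable_cong_sets[OF DeltaD(2)[OF \<pi> x] refl] by blast
  then show ?thesis unfolding set_integrable_def
    by (intro integrable_const_bound[where B = b]) (auto simp: indicator_def b \<open>0 \<le> b\<close>)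
qed

text \<open>The constant \<open>e\<close>, of either sign, passes through the average unchanged
  because \<open>\<pi> x\<close> gives \<open>As x\<close> full mass.\<close>

lemma avg_mono:
  assumes F: "F \<in> borel_measurable (bor K)" and G: "G \<in> borel_measurable (bor K)"
    and \<pi>: "\<pi> \<in> Delta X A As" and x: "x \<in> X"
    and bF: "\<And>a. a \<in> As x \<Longrightarrow> \<bar>F (x, a)\<bar> \<le> b" and bG: "\<And>a. a \<in> As x \<Longrightarrow> \<bar>G (x, a)\<bar> \<le> b'"
    and le: "\<And>a. a \<in> As x \<Longrightarrow> F (x, a) \<le> G (x, a) + e"
  shows "avg F \<pi> x \<le> avg G \<pi> x + e"
proof -
  interpret prob_space "\<pi> x" by (rule DeltaD(1)[OF \<pi> x])
  have iF: "set_integrable (\<pi> x) (As x) (\<lambda>a. F (x, a))" by (rule section_integrable[OF F \<pi> x bF])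
  have iG: "set_integrable (\<pi> x) (As x) (\<lambda>a. G (x, a))" by (rule section_integrable[OF G \<pi> x bG])
  have ie: "set_integrable (\<pi> x) (As x) (\<lambda>a. e)"
    unfolding set_integrable_def using DeltaD(4)[OF \<pi> x] by (intro integrable_const_bound[where B = "\<bar>e\<bar>"]) (auto simp: indicator_def)
  have "avg F \<pi> x \<le> (LINT a:As x|\<pi> x. G (x, a) + e)"
    unfolding avg_def using le by (intro set_integral_mono iF set_integral_add(1) iG ie)
  also have "\<dots> = avg G \<pi> x + (LINT a:As x|\<pi> x. e)"
    unfolding avg_def by (rule set_integral_add(2)[OF iG ie])
  also have "(LINT a:As x|\<pi> x. e) = e"
    unfolding set_lebesgue_integral_def using DeltaD(3,4)[OF \<pi> x] by simp
  finally show ?thesis .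
qed

lemma avg_zero: "avg (\<lambda>p. 0) \<pi> x = 0"
  unfolding avg_def by (simp add: set_lebesgue_integral_def)

lemma avg_abs_le:
  assumes F: "F \<in> borel_measurable (bor K)" and \<pi>: "\<pi> \<in> Delta X A As" and x: "x \<in> X"
    and b: "\<And>a. a \<in> As x \<Longrightarrow> \<bar>F (x, a)\<bar> \<le> b"
  shows "\<bar>avg F \<pi> x\<bar> \<le> b"
proof -
  have zero: "(\<lambda>p. 0) \<in> borel_measurable (bor K)" "\<And>a. a \<in> As x \<Longrightarrow> \<bar>(\<lambda>p. 0) (x, a)\<bar> \<le> (0::real)"
    by simp_all
  have "avg F \<pi> x \<le> avg (\<lambda>p. 0) \<pi> x + b"
    by (rule avg_mono[OF F zero(1) \<pi> x b zero(2) abs_leD(1)[OF b]])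
  moreover have "avg (\<lambda>p. 0) \<pi> x \<le> avg F \<pi> x + b"
    by (rule avg_mono[OF zero(1) F \<pi> x zero(2) b abs_leD(2)[OF b]])
  ultimately show ?thesis unfolding avg_zero by simp
qed

text \<open>\<open>Fpol\<close> integrates cost and risk separately. Both are bounded on the section
  at x, hence integrable, so the two integrals combine.\<close>

lemma Fpol_eq_avg:
  assumes \<pi>: "\<pi> \<in> Delta X A As" and x: "x \<in> X" and v: "v \<in> \<B>"
  shows "Fpol As c R \<alpha> \<pi> v x = avg (H v) \<pi> x"
proof -
  obtain b where b: "0 \<le> b" "\<And>x. x \<in> X \<Longrightarrow> \<bar>v x\<bar> \<le> b * w x" using v by (rule BwE) blast
  have "set_integrable (\<pi> x) (As x) (\<lambda>a. c (x, a))"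
    by (rule section_integrable[OF measurable_c \<pi> x c_bound[OF x]])
  moreover have "set_integrable (\<pi> x) (As x) (\<lambda>a. R v (x, a))"
    by (rule section_integrable[OF R_measurable[OF v] \<pi> x R_abs_le[OF v b x]])
  ultimately show ?thesis
    unfolding Fpol_def cpol_def Rpol_def avg_def H_def by (simp add: set_integral_add)
qed

lemma Fpol_mono:
  assumes \<pi>: "\<pi> \<in> Delta X A As" and x: "x \<in> X" and u: "u \<in> \<B>" and v: "v \<in> \<B>"
    and d: "0 \<le> d" "\<And>y. y \<in> X \<Longrightarrow> u y \<le> v y + d * w y"
  shows "Fpol As c R \<alpha> \<pi> u x \<le> Fpol As c R \<alpha> \<pi> v x + \<gamma> * (d * w x)"
proof -
  obtain b where b: "0 \<le> b" "\<And>x. x \<in> X \<Longrightarrow> \<bar>u x\<bar> \<le> b * w x" using u by (rule BwE) blast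
  obtain b' where b': "0 \<le> b'" "\<And>x. x \<in> X \<Longrightarrow> \<bar>v x\<bar> \<le> b' * w x" using v by (rule BwE) blast
  show ?thesis unfolding Fpol_eq_avg[OF \<pi> x u] Fpol_eq_avg[OF \<pi> x v]
    by (rule avg_mono[OF H_measurable[OF u] H_measurable[OF v] \<pi> x H_abs_le[OF u b x]
          H_abs_le[OF v b' x] H_lipschitz[OF x _ u v d]])
qed

lemma Fpol_Bw:
  assumes \<pi>: "\<pi> \<in> Delta X A As" and v: "v \<in> \<B>"
  shows "Fpol As c R \<alpha> \<pi> v \<in> \<B>"
proof -
  obtain b where b: "0 \<le> b" "\<And>x. x \<in> X \<Longrightarrow> \<bar>v x\<bar> \<le> b * w x" using v by (rule BwE) blast
  show ?thesis
  proof (rule BwI[where b = "cbar + \<gamma> * b"])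
    show "Fpol As c R \<alpha> \<pi> v \<in> borel_measurable (bor X)"
      using avg_measurable[OF H_measurable[OF v] \<pi>]
      by (rule measurable_cong[THEN iffD1, rotated]) (simp add: Fpol_eq_avg[OF \<pi> _ v] space_restrict_space)
    fix x assume x: "x \<in> X"
    show "\<bar>Fpol As c R \<alpha> \<pi> v x\<bar> \<le> (cbar + \<gamma> * b) * w x"
      unfolding Fpol_eq_avg[OF \<pi> x v]
      by (rule avg_abs_le[OF H_measurable[OF v] \<pi> x H_abs_le[OF v b x]])
  qed
qed

lemma Fpol_ge_min:
  assumes \<pi>: "\<pi> \<in> Delta X A As" and x: "x \<in> X" and v: "v \<in> \<B>"
    and m: "\<And>a. a \<in> As x \<Longrightarrow> m \<le> H v (x, a)"
  shows "m \<le> Fpol As c R \<alpha> \<pi> v x"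
proof -
  obtain b where b: "0 \<le> b" "\<And>x. x \<in> X \<Longrightarrow> \<bar>v x\<bar> \<le> b * w x" using v by (rule BwE) blast
  \<comment> \<open>The bound \<open>m\<close> enters as the shift \<open>- m\<close> in a
    comparison with the zero function.\<close>
  have "avg (\<lambda>p. 0) \<pi> x \<le> avg (H v) \<pi> x + (- m)"
    by (rule avg_mono[OF _ H_measurable[OF v] \<pi> x _ H_abs_le[OF v b x], where b = 0]) (use m in auto)
  then show ?thesis unfolding Fpol_eq_avg[OF \<pi> x v] avg_zero by simp
qed

section \<open>Deterministic policies and the fixed point of the optimality operator\<close>

definition dirac :: "('x \<Rightarrow> 'a) \<Rightarrow> 'x \<Rightarrow> 'a measure" where
  "dirac g x = return (bor A) (g x)"

lemma dirac_Delta: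
  assumes "greedy v g"
  shows "dirac g \<in> Delta X A As"
proof -
  have g: "g \<in> measurable (bor X) (bor A)" using assms by (simp add: greedy_def)
  have "dirac g \<in> measurable (bor X) (prob_algebra (bor A))"
    unfolding dirac_def[abs_def] by (rule measurable_compose[OF g measurable_return_prob_space])
  moreover have "measure (dirac g x) (As x) = 1" if "x \<in> X" for x
  proof -
    have "As x \<in> sets (bor A)" using As[OF that] borel_A by (simp add: sets_restrict_space_iff)
    then show ?thesis unfolding dirac_def using greedyD(1)[OF assms that] by (simp add: measure_return)
  qed
  ultimately show ?thesis unfolding Delta_def by simp
qed

lemma Fpol_dirac:
  assumes g: "greedy u g" and x: "x \<in> X" and v: "v \<in> \<B>"
  shows "Fpol As c R \<alpha> (dirac g) v x = H v (x, g x)"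
proof -
  have gx: "g x \<in> As x" "g x \<in> space (bor A)"
    using greedyD(1)[OF g x] As[OF x] by (auto simp: space_restrict_space)
  have "(\<lambda>a. indicator (As x) a *\<^sub>R H v (x, a)) \<in> borel_measurable (bor A)"
    using measurable_compose[OF measurable_Pair1'[of x "bor X" "bor A"]
        joint_measurable[OF H_measurable[OF v]]] x
    by (simp add: space_restrict_space)
  then have "avg (H v) (dirac g) x = indicator (As x) (g x) *\<^sub>R H v (x, g x)"
    unfolding avg_def dirac_def set_lebesgue_integral_def using gx(2) by (intro integral_return) auto
  then show ?thesis using Fpol_eq_avg[OF dirac_Delta[OF g] x v] gx(1) by simp
qed

text \<open>The greedy Dirac policy attains the lower bound valid for all randomised policies, so
  the real-valued infimum is a genuine minimum.\<close>

lemma Fopt_eq_greedy: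
  assumes v: "v \<in> \<B>" and g: "greedy v g" and x: "x \<in> X"
  shows "Fopt X A As c R \<alpha> v x = H v (x, g x)"
  unfolding Fopt_def
proof (rule cInf_eq_minimum)
  show "H v (x, g x) \<in> (\<lambda>\<pi>. Fpol As c R \<alpha> \<pi> v x) ` Delta X A As"
    using Fpol_dirac[OF g x v] dirac_Delta[OF g] by (intro image_eqI[of _ _ "dirac g"]) simp_all
  fix y assume "y \<in> (\<lambda>\<pi>. Fpol As c R \<alpha> \<pi> v x) ` Delta X A As"
  then show "H v (x, g x) \<le> y"
    using Fpol_ge_min[OF _ x v greedyD(2)[OF g x]] by blast
qed

text \<open>Measurability of the infimum comes from the greedy selector: on \<open>X\<close> the
  operator agrees with the one of a single policy.\<close>

lemma Fopt_Bw:
  assumes v: "v \<in> \<B>"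
  shows "Fopt X A As c R \<alpha> v \<in> \<B>"
proof -
  obtain g where g: "greedy v g" using greedy_exists[OF v] by blast
  have eq: "Fopt X A As c R \<alpha> v x = Fpol As c R \<alpha> (dirac g) v x" if "x \<in> X" for x
    using Fopt_eq_greedy[OF v g that] Fpol_dirac[OF g that v] by simp
  have F: "Fpol As c R \<alpha> (dirac g) v \<in> \<B>" by (rule Fpol_Bw[OF dirac_Delta[OF g] v])
  then obtain b where b: "0 \<le> b" "\<And>x. x \<in> X \<Longrightarrow> \<bar>Fpol As c R \<alpha> (dirac g) v x\<bar> \<le> b * w x" by (rule BwE) blast
  show ?thesis
  proof (rule BwI[where b = b])
    show "Fopt X A As c R \<alpha> v \<in> borel_measurable (bor X)"
      using Bw_measurable[OF F]
      by (rule measurable_cong[THEN iffD1, rotated]) (simp add: eq space_restrict_space)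
  qed (use b eq in simp)
qed

lemma Fopt_mono:
  assumes u: "u \<in> \<B>" and v: "v \<in> \<B>" and x: "x \<in> X"
    and d: "0 \<le> d" "\<And>y. y \<in> X \<Longrightarrow> u y \<le> v y + d * w y"
  shows "Fopt X A As c R \<alpha> u x \<le> Fopt X A As c R \<alpha> v x + \<gamma> * (d * w x)"
proof -
  obtain g where g: "greedy u g" using greedy_exists[OF u] by blast
  obtain h where h: "greedy v h" using greedy_exists[OF v] by blast
  have hx: "h x \<in> As x" by (rule greedyD(1)[OF h x])
  \<comment> \<open>The minimiser for \<open>v\<close> is a competitor in the minimisation for
    \<open>u\<close>.\<close>
  have "H u (x, g x) \<le> H u (x, h x)" by (rule greedyD(2)[OF g x hx])
  also have "\<dots> \<le> H v (x, h x) + \<gamma> * (d * w x)" by (rule H_lipschitz[OF x hx u v d])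
  finally show ?thesis unfolding Fopt_eq_greedy[OF u g x] Fopt_eq_greedy[OF v h x] .
qed

lemma Fopt_contraction:
  assumes u: "u \<in> \<B>" and v: "v \<in> \<B>" and x: "x \<in> X"
    and d: "0 \<le> d" "\<And>y. y \<in> X \<Longrightarrow> \<bar>u y - v y\<bar> \<le> d * w y"
  shows "\<bar>Fopt X A As c R \<alpha> u x - Fopt X A As c R \<alpha> v x\<bar> \<le> \<gamma> * d * w x"
proof -
  have "Fopt X A As c R \<alpha> u x \<le> Fopt X A As c R \<alpha> v x + \<gamma> * (d * w x)"
    by (rule Fopt_mono[OF u v x d(1) abs_diff_leD(1)[OF d(2)]])
  moreover have "Fopt X A As c R \<alpha> v x \<le> Fopt X A As c R \<alpha> u x + \<gamma> * (d * w x)"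
    by (rule Fopt_mono[OF v u x d(1) abs_diff_leD(2)[OF d(2)]])
  ultimately show ?thesis by (simp add: abs_le_iff algebra_simps)
qed

lemma power_\<gamma>_tendsto: "(\<lambda>n. C * \<gamma> ^ n) \<longlonglongrightarrow> 0"
  using tendsto_mult[OF tendsto_const LIMSEQ_realpow_zero[OF \<gamma>_nonneg \<alpha>_wbar], of C] by simp

lemma Fopt_fixed_point_unique:
  assumes u: "u \<in> \<B>" "\<And>x. x \<in> X \<Longrightarrow> Fopt X A As c R \<alpha> u x = u x"
    and v: "v \<in> \<B>" "\<And>x. x \<in> X \<Longrightarrow> Fopt X A As c R \<alpha> v x = v x" and x: "x \<in> X"
  shows "u x = v x"
proof -
  obtain b where b: "0 \<le> b" "\<And>x. x \<in> X \<Longrightarrow> \<bar>u x\<bar> \<le> b * w x" using u(1) by (rule BwE) blast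
  obtain b' where b': "0 \<le> b'" "\<And>x. x \<in> X \<Longrightarrow> \<bar>v x\<bar> \<le> b' * w x" using v(1) by (rule BwE) blast
  \<comment> \<open>The two weighted bounds give a first estimate, and every use of the fixed-point
    equations gains a factor \<gamma>.\<close>
  have "\<forall>y\<in>X. \<bar>u y - v y\<bar> \<le> (b + b') * \<gamma> ^ n * w y" for n
  proof (induction n)
    case 0
    show ?case
    proof
      fix y assume "y \<in> X"
      then show "\<bar>u y - v y\<bar> \<le> (b + b') * \<gamma> ^ 0 * w y"
        using b(2)[of y] b'(2)[of y] by (simp add: distrib_right)
    qed
  next
    case (Suc n)
    show ?case
    proof
      fix y assume y: "y \<in> X"
      have "\<bar>Fopt X A As c R \<alpha> u y - Fopt X A As c R \<alpha> v y\<bar> \<le> \<gamma> * ((b + b') * \<gamma> ^ n) * w y"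
        using Suc b(1) b'(1) \<gamma>_nonneg by (intro Fopt_contraction u v y) auto
      then show "\<bar>u y - v y\<bar> \<le> (b + b') * \<gamma> ^ Suc n * w y"
        using u(2)[OF y] v(2)[OF y] by (simp add: algebra_simps)
    qed
  qed
  then have "\<bar>u x - v x\<bar> \<le> (b + b') * w x * \<gamma> ^ n" for n using x by (simp add: algebra_simps)
  then have "\<bar>u x - v x\<bar> \<le> 0" by (intro LIMSEQ_le_const[OF power_\<gamma>_tendsto]) auto
  then show ?thesis by simp
qed

text \<open>Value iteration from 0 converges pointwise with a geometric error proportional to
  \<open>w\<close>; this uniformity puts the limit into the weighted space and carries the
  fixed-point equation over to it.\<close>

lemma Fopt_fixed_point_exists:
  obtains v where "v \<in> \<B>" "\<And>x. x \<in> X \<Longrightarrow> Fopt X A As c R \<alpha> v x = v x"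
proof -
  define V where "V n = (Fopt X A As c R \<alpha> ^^ n) (\<lambda>x. 0)" for n
  have VS: "V (Suc n) = Fopt X A As c R \<alpha> (V n)" for n unfolding V_def by simp
  have VB: "V n \<in> \<B>" for n
  proof (induction n)
    case 0
    show ?case unfolding V_def by (simp add: Bw_zero)
  next
    case (Suc n)
    then show ?case unfolding VS by (rule Fopt_Bw)
  qed
  obtain b where b: "0 \<le> b" "\<And>x. x \<in> X \<Longrightarrow> \<bar>V 1 x\<bar> \<le> b * w x" using VB[of 1] by (rule BwE) blast
  have inc: "\<forall>x\<in>X. \<bar>V (Suc n) x - V n x\<bar> \<le> b * \<gamma> ^ n * w x" for n
  proof (induction n)
    case 0
    then show ?case using b(2) by (simp add: V_def)
  next
    case (Suc n)
    show ?case
    proof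
      fix x assume x: "x \<in> X"
      have "\<bar>V (Suc (Suc n)) x - V (Suc n) x\<bar> \<le> \<gamma> * (b * \<gamma> ^ n) * w x"
        unfolding VS[of "Suc n"] VS[of n]
        using Suc b(1) \<gamma>_nonneg by (intro Fopt_contraction x) (auto simp: VS[symmetric] VB)
      then show "\<bar>V (Suc (Suc n)) x - V (Suc n) x\<bar> \<le> b * \<gamma> ^ Suc n * w x"
        by (simp add: algebra_simps)
    qed
  qed
  have "\<exists>l. (\<lambda>n. V n x) \<longlonglongrightarrow> l \<and> (\<forall>n. \<bar>l - V n x\<bar> \<le> b * w x / (1 - \<gamma>) * \<gamma> ^ n)" if "x \<in> X" for x
    by (rule geometric_increments_limit[of "\<lambda>n. V n x" "b * w x" \<gamma>])
      (use inc that \<gamma>_nonneg \<alpha>_wbar in \<open>auto simp: algebra_simps\<close>)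
  then obtain v where lim: "\<And>x. x \<in> X \<Longrightarrow> (\<lambda>n. V n x) \<longlonglongrightarrow> v x"
    and close: "\<And>x n. x \<in> X \<Longrightarrow> \<bar>v x - V n x\<bar> \<le> b * w x / (1 - \<gamma>) * \<gamma> ^ n"
    by metis
  define C where "C = b / (1 - \<gamma>)"
  have "0 \<le> C" unfolding C_def using b(1) \<alpha>_wbar by simp
  have close: "\<bar>v x - V n x\<bar> \<le> C * \<gamma> ^ n * w x" if "x \<in> X" for x n
    using close[OF that, of n] unfolding C_def by (simp add: algebra_simps)
  have vB: "v \<in> \<B>"
  proof (rule BwI[where b = C])
    show "v \<in> borel_measurable (bor X)"
      by (rule borel_measurable_LIMSEQ_metric[OF Bw_measurable[OF VB] lim]) (simp add: space_restrict_space)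
    \<comment> \<open>This is the error bound at n = 0, where the iterate is the zero
      function.\<close>
    show "\<bar>v x\<bar> \<le> C * w x" if "x \<in> X" for x using close[OF that, of 0] by (simp add: V_def)
  qed
  show ?thesis
  proof (rule that[OF vB])
    fix x assume x: "x \<in> X"
    \<comment> \<open>Both terms are compared with \<open>V (Suc n) x\<close>, which accounts for
      the factor 2.\<close>
    have "\<bar>Fopt X A As c R \<alpha> v x - v x\<bar> \<le> 2 * C * \<gamma> * w x * \<gamma> ^ n" for n
    proof -
      have "\<bar>Fopt X A As c R \<alpha> v x - V (Suc n) x\<bar> \<le> \<gamma> * (C * \<gamma> ^ n) * w x"
        unfolding VS using close \<open>0 \<le> C\<close> \<gamma>_nonneg by (intro Fopt_contraction vB VB x) auto
      moreover have "\<bar>v x - V (Suc n) x\<bar> \<le> C * \<gamma> ^ Suc n * w x" by (rule close[OF x])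
      ultimately show ?thesis by (simp add: algebra_simps)
    qed
    then have "\<bar>Fopt X A As c R \<alpha> v x - v x\<bar> \<le> 0" by (intro LIMSEQ_le_const[OF power_\<gamma>_tendsto]) auto
    then show "Fopt X A As c R \<alpha> v x = v x" by simp
  qed
qed

section \<open>Finite horizons and the discounted limit\<close>

abbreviation "J T ps \<equiv> JT As c R \<alpha> T ps"

lemma Markov_policiesD:
  assumes "ps \<in> Markov_policies X A As"
  shows "ps 0 \<in> Delta X A As" "(\<lambda>n. ps (Suc n)) \<in> Markov_policies X A As"
  using assms unfolding Markov_policies_def by auto

text \<open>The last stage has a cost but no risk term; normalisation of the risk map turns it into
  one more operator, applied to 0. Horizon T thus involves T + 1 operators, whence the exponents
  \<open>Suc T\<close> below.\<close>

lemma JT_0: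
  assumes "x \<in> X"
  shows "J 0 ps x = Fpol As c R \<alpha> (ps 0) (\<lambda>x. 0) x"
proof -
  have "Rpol As R (ps 0) (\<lambda>x. 0) x = (LINT a:As x|ps 0 x. 0)"
    unfolding Rpol_def set_lebesgue_integral_def
    using assms by (intro Bochner_Integration.integral_cong) (auto simp: indicator_def R_zero)
  then show ?thesis unfolding Fpol_def by (simp add: set_lebesgue_integral_def)
qed

lemma JT_Suc: "J (Suc T) ps = Fpol As c R \<alpha> (ps 0) (J T (\<lambda>n. ps (Suc n)))"
  unfolding Fpol_def[abs_def] by simp

lemma JT_Bw:
  assumes "ps \<in> Markov_policies X A As"
  shows "J T ps \<in> \<B>"
  using assms
proof (induction T arbitrary: ps)
  case 0
  have F: "Fpol As c R \<alpha> (ps 0) (\<lambda>x. 0) \<in> \<B>" by (rule Fpol_Bw[OF Markov_policiesD(1)[OF 0] Bw_zero])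
  then obtain b where b: "0 \<le> b" "\<And>x. x \<in> X \<Longrightarrow> \<bar>Fpol As c R \<alpha> (ps 0) (\<lambda>x. 0) x\<bar> \<le> b * w x" by (rule BwE) blast
  show ?case
  proof (rule BwI[where b = b])
    show "J 0 ps \<in> borel_measurable (bor X)"
      using Bw_measurable[OF F]
      by (rule measurable_cong[THEN iffD1, rotated]) (simp add: JT_0 space_restrict_space del: JT.simps)
  qed (use b JT_0 in simp)
next
  case (Suc T)
  show ?case unfolding JT_Suc
    by (rule Fpol_Bw[OF Markov_policiesD(1)[OF Suc.prems] Suc.IH[OF Markov_policiesD(2)[OF Suc.prems]]])
qed

lemma Fpol_contraction:
  assumes "\<pi> \<in> Delta X A As" "u \<in> \<B>" "v \<in> \<B>" "x \<in> X" "0 \<le> d" "\<And>y. y \<in> X \<Longrightarrow> \<bar>u y - v y\<bar> \<le> d * w y"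
  shows "\<bar>Fpol As c R \<alpha> \<pi> u x - Fpol As c R \<alpha> \<pi> v x\<bar> \<le> \<gamma> * d * w x"
proof -
  have "Fpol As c R \<alpha> \<pi> u x \<le> Fpol As c R \<alpha> \<pi> v x + \<gamma> * (d * w x)"
    by (rule Fpol_mono[OF assms(1,4,2,3,5) abs_diff_leD(1)[OF assms(6)]])
  moreover have "Fpol As c R \<alpha> \<pi> v x \<le> Fpol As c R \<alpha> \<pi> u x + \<gamma> * (d * w x)"
    by (rule Fpol_mono[OF assms(1,4,3,2,5) abs_diff_leD(2)[OF assms(6)]])
  ultimately show ?thesis by (simp add: abs_le_iff algebra_simps)
qed

lemma Fpol_zero_abs_le:
  assumes \<pi>: "\<pi> \<in> Delta X A As" and x: "x \<in> X"
  shows "\<bar>Fpol As c R \<alpha> \<pi> (\<lambda>x. 0) x\<bar> \<le> cbar * w x"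
  unfolding Fpol_eq_avg[OF \<pi> x Bw_zero]
  by (rule avg_abs_le[OF H_measurable[OF Bw_zero] \<pi> x]) (use H_abs_le[OF Bw_zero, of 0 x] x in simp)

text \<open>The two horizons share their outer operators and differ only at the innermost argument:
  a one-stage cost, at most \<open>cbar * w\<close>, against 0. The induction ranges over all
  policies since each layer shifts the policy.\<close>

lemma JT_increment:
  assumes "ps \<in> Markov_policies X A As" "x \<in> X"
  shows "\<bar>J (Suc T) ps x - J T ps x\<bar> \<le> cbar * \<gamma> ^ Suc T * w x"
  using assms
proof (induction T arbitrary: ps x)
  case 0
  note ps = Markov_policiesD[OF 0(1)]
  have "\<bar>Fpol As c R \<alpha> (ps 0) (J 0 (\<lambda>n. ps (Suc n))) x - Fpol As c R \<alpha> (ps 0) (\<lambda>x. 0) x\<bar> \<le> \<gamma> * cbar * w x"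
  proof (rule Fpol_contraction[OF ps(1) JT_Bw[OF ps(2)] Bw_zero 0(2) cbar])
    fix y assume y: "y \<in> X"
    show "\<bar>J 0 (\<lambda>n. ps (Suc n)) y - 0\<bar> \<le> cbar * w y"
      unfolding diff_zero JT_0[OF y] by (rule Fpol_zero_abs_le[OF Markov_policiesD(1)[OF ps(2)] y])
  qed
  then show ?case unfolding JT_Suc JT_0[OF 0(2)] by (simp add: algebra_simps)
next
  case (Suc T)
  note ps = Markov_policiesD[OF Suc(2)]
  have "\<bar>Fpol As c R \<alpha> (ps 0) (J (Suc T) (\<lambda>n. ps (Suc n))) x - Fpol As c R \<alpha> (ps 0) (J T (\<lambda>n. ps (Suc n))) x\<bar>
    \<le> \<gamma> * (cbar * \<gamma> ^ Suc T) * w x"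
    using cbar \<gamma>_nonneg Suc.IH[OF ps(2)]
    by (intro Fpol_contraction[OF ps(1) JT_Bw[OF ps(2)] JT_Bw[OF ps(2)] Suc(3)]) auto
  then show ?case unfolding JT_Suc[of "Suc T"] JT_Suc[of T ps] by (simp add: algebra_simps)
qed

text \<open>Convergence gives the \<open>lim\<close> in \<open>Jdisc\<close> its intended
  meaning.\<close>

lemma JT_tendsto_Jdisc:
  assumes "ps \<in> Markov_policies X A As" "x \<in> X"
  shows "(\<lambda>T. J T ps x) \<longlonglongrightarrow> Jdisc As c R \<alpha> ps x"
proof -
  obtain l where "(\<lambda>T. J T ps x) \<longlonglongrightarrow> l"
    by (rule geometric_increments_limit[of "\<lambda>T. J T ps x" "cbar * \<gamma> * w x" \<gamma>])
      (use JT_increment[OF assms] \<gamma>_nonneg \<alpha>_wbar in \<open>auto simp: algebra_simps\<close>)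
  then show ?thesis unfolding Jdisc_def by (simp add: limI)
qed

text \<open>Iterating \<open>sub\<close> puts \<open>v\<close> below all stages of the policy.
  Replacing it there by 0 costs at most \<open>b * w\<close>, damped by \<gamma> at each of the T +
  1 operators.\<close>

lemma value_le_JT:
  assumes v: "v \<in> \<B>" "0 \<le> b" "\<And>x. x \<in> X \<Longrightarrow> \<bar>v x\<bar> \<le> b * w x"
    and sub: "\<And>\<pi> x. \<pi> \<in> Delta X A As \<Longrightarrow> x \<in> X \<Longrightarrow> v x \<le> Fpol As c R \<alpha> \<pi> v x"
    and ps: "ps \<in> Markov_policies X A As" and x: "x \<in> X"
  shows "v x \<le> J T ps x + b * \<gamma> ^ Suc T * w x"
  using ps x
proof (induction T arbitrary: ps x)
  case 0
  note ps = Markov_policiesD[OF 0(1)]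
  have "Fpol As c R \<alpha> (ps 0) v x \<le> Fpol As c R \<alpha> (ps 0) (\<lambda>x. 0) x + \<gamma> * (b * w x)"
    by (rule Fpol_mono[OF ps(1) 0(2) v(1) Bw_zero v(2) abs_leD(1)[OF v(3)]])
  then show ?case using sub[OF ps(1) 0(2)] unfolding JT_0[OF 0(2)] by (simp add: algebra_simps)
next
  case (Suc T)
  note ps = Markov_policiesD[OF Suc(2)]
  have "Fpol As c R \<alpha> (ps 0) v x
    \<le> Fpol As c R \<alpha> (ps 0) (J T (\<lambda>n. ps (Suc n))) x + \<gamma> * (b * \<gamma> ^ Suc T * w x)"
    using v(2) \<gamma>_nonneg by (intro Fpol_mono[OF ps(1) Suc(3) v(1) JT_Bw[OF ps(2)]] Suc.IH ps) auto
  then show ?case using sub[OF ps(1) Suc(3)] unfolding JT_Suc by (simp add: algebra_simps)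
qed

text \<open>Shifting a constant policy changes nothing, so one \<pi> serves in the whole induction;
  the terminal error is damped as in \<open>value_le_JT\<close>.\<close>

lemma JT_stationary_le_value:
  assumes v: "v \<in> \<B>" "0 \<le> b" "\<And>x. x \<in> X \<Longrightarrow> \<bar>v x\<bar> \<le> b * w x"
    and \<pi>: "\<pi> \<in> Delta X A As" and fp: "\<And>x. x \<in> X \<Longrightarrow> Fpol As c R \<alpha> \<pi> v x = v x" and x: "x \<in> X"
  shows "J T (\<lambda>n. \<pi>) x \<le> v x + b * \<gamma> ^ Suc T * w x"
  using x
proof (induction T arbitrary: x)
  case 0
  have "Fpol As c R \<alpha> \<pi> (\<lambda>x. 0) x \<le> Fpol As c R \<alpha> \<pi> v x + \<gamma> * (b * w x)"
    by (rule Fpol_mono[OF \<pi> 0 Bw_zero v(1,2) abs_leD(2)[OF v(3)]])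
  then show ?case using fp[OF 0] unfolding JT_0[OF 0] by (simp add: algebra_simps)
next
  case (Suc T)
  have ps: "(\<lambda>n::nat. \<pi>) \<in> Markov_policies X A As" using \<pi> unfolding Markov_policies_def by simp
  have "Fpol As c R \<alpha> \<pi> (J T (\<lambda>n. \<pi>)) x \<le> Fpol As c R \<alpha> \<pi> v x + \<gamma> * (b * \<gamma> ^ Suc T * w x)"
    using v(2) \<gamma>_nonneg by (intro Fpol_mono[OF \<pi> Suc(2) JT_Bw[OF ps] v(1)] Suc.IH) auto
  then show ?case using fp[OF Suc(2)] unfolding JT_Suc by (simp add: algebra_simps)
qed

theorem fixed_point_eq_Jopt:
  assumes v: "v \<in> \<B>" and fp: "\<And>x. x \<in> X \<Longrightarrow> Fopt X A As c R \<alpha> v x = v x" and x: "x \<in> X"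
  shows "v x = Jopt X A As c R \<alpha> x"
proof -
  obtain b where b: "0 \<le> b" "\<And>x. x \<in> X \<Longrightarrow> \<bar>v x\<bar> \<le> b * w x" using v by (rule BwE) blast
  obtain g where g: "greedy v g" using greedy_exists[OF v] by blast
  have Hv: "H v (y, g y) = v y" if "y \<in> X" for y
    using Fopt_eq_greedy[OF v g that] fp[OF that] by simp
  have sub: "v y \<le> Fpol As c R \<alpha> \<pi> v y" if "\<pi> \<in> Delta X A As" "y \<in> X" for \<pi> y
    using Fpol_ge_min[OF that v greedyD(2)[OF g that(2)]] Hv[OF that(2)] by simp
  let ?\<pi> = "dirac g"
  have \<pi>: "?\<pi> \<in> Delta X A As" by (rule dirac_Delta[OF g])
  have fpp: "Fpol As c R \<alpha> ?\<pi> v y = v y" if "y \<in> X" for y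
    using Fpol_dirac[OF g that v] Hv[OF that] by simp
  have ps: "(\<lambda>n. ?\<pi>) \<in> Markov_policies X A As" using \<pi> unfolding Markov_policies_def by simp
  have err: "(\<lambda>T. b * \<gamma> ^ Suc T * w x) \<longlonglongrightarrow> 0"
    using power_\<gamma>_tendsto[of "b * \<gamma> * w x"] by (simp add: algebra_simps)
  have lower: "v x \<le> Jdisc As c R \<alpha> qs x" if "qs \<in> Markov_policies X A As" for qs
  proof -
    have "(\<lambda>T. J T qs x + b * \<gamma> ^ Suc T * w x) \<longlonglongrightarrow> Jdisc As c R \<alpha> qs x"
      using tendsto_add[OF JT_tendsto_Jdisc[OF that x] err] by simp
    then show ?thesis
      by (rule LIMSEQ_le_const) (use value_le_JT[OF v b sub that x] in auto)
  qed
  have "(\<lambda>T. v x + b * \<gamma> ^ Suc T * w x) \<longlonglongrightarrow> v x"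
    using tendsto_add[OF tendsto_const err, of "v x"] by simp
  then have "Jdisc As c R \<alpha> (\<lambda>n. ?\<pi>) x \<le> v x"
    by (rule LIMSEQ_le[OF JT_tendsto_Jdisc[OF ps x]])
      (use JT_stationary_le_value[OF v b \<pi> fpp x] in auto)
  then have "Jdisc As c R \<alpha> (\<lambda>n. ?\<pi>) x = v x" using lower[OF ps] by simp
  \<comment> \<open>The stationary greedy policy attains the common lower bound, so the infimum is a
    minimum.\<close>
  then have "Jopt X A As c R \<alpha> x = v x"
    unfolding Jopt_def using ps lower by (intro cInf_eq_minimum) (force simp: image_iff)+
  then show ?thesis by simp
qed

end

theorem theorem5p5:
  fixes X :: "'x::polish_space set"
    and A :: "'a::polish_space set"
    and As :: "'x \<Rightarrow> 'a set"
    and Q :: "'x \<times> 'a \<Rightarrow> 'x measure"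
    and c :: "'x \<times> 'a \<Rightarrow> real"
    and w :: "'x \<Rightarrow> real"
    and R :: "('x \<Rightarrow> real) \<Rightarrow> 'x \<times> 'a \<Rightarrow> real"
    and \<alpha> cbar wbar :: real
  assumes "markov_control_process X A As Q c"
    and "w \<in> borel_measurable (restrict_space borel X)"
    and "\<forall>x\<in>X. 1 \<le> w x"
    and "risk_map X As w R"
    and "0 \<le> \<alpha>" and "\<alpha> < 1"
    and "0 \<le> cbar" and "1 \<le> wbar" and "\<alpha> \<noteq> 0 \<longrightarrow> wbar < 1 / \<alpha>"
    and "\<forall>x\<in>X. (SUP a\<in>As x. ereal \<bar>c (x, a)\<bar>) \<le> ereal (cbar * w x)"
    and "\<forall>x\<in>X. (SUP a\<in>As x. Rsharp_bar X w R w (x, a)) \<le> ereal (wbar * w x)"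
    and "\<forall>x\<in>X. lsc_on (As x) (\<lambda>a. c (x, a))"
    and "\<forall>x\<in>X. compact (As x)"
    and "\<forall>x\<in>X. \<forall>u\<in>Bw X w. continuous_on (As x) (\<lambda>a. R u (x, a))"
  shows "\<exists>vstar\<in>Bw X w.
      (\<forall>x\<in>X. Fopt X A As c R \<alpha> vstar x = vstar x) \<and>
      (\<forall>u\<in>Bw X w. (\<forall>x\<in>X. Fopt X A As c R \<alpha> u x = u x) \<longrightarrow> (\<forall>x\<in>X. u x = vstar x)) \<and>
      (\<forall>x\<in>X. \<exists>a. is_arg_min (\<lambda>a. c (x, a) + \<alpha> * R vstar (x, a)) (\<lambda>a. a \<in> As x) a \<and>
                 vstar x = c (x, a) + \<alpha> * R vstar (x, a)) \<and>
      (\<forall>x\<in>X. vstar x = Jopt X A As c R \<alpha> x)"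
proof -
  interpret markov_control_process X A As Q c by (rule assms(1))
  interpret bounded_risk_mcp X A As Q c w R \<alpha> cbar wbar
  proof
    \<comment> \<open>For \<alpha> = 0 the product vanishes, in accordance with reading 1/0 as
      infinity.\<close>
    show "\<alpha> * wbar < 1" using assms(5,9) by (cases "\<alpha> = 0") (auto simp: field_simps)
    show "\<bar>c (x, a)\<bar> \<le> cbar * w x" if "x \<in> X" "a \<in> As x" for x a
      using assms(10) that by (auto simp: SUP_le_iff)
    show "Rsharp_bar X w R w (x, a) \<le> ereal (wbar * w x)" if "x \<in> X" "a \<in> As x" for x a
      using assms(11) that by (auto simp: SUP_le_iff)
  qed (use assms in auto)
  obtain v where v: "v \<in> Bw X w" "\<And>x. x \<in> X \<Longrightarrow> Fopt X A As c R \<alpha> v x = v x"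
    by (rule Fopt_fixed_point_exists) blast
  \<comment> \<open>The greedy action is a minimiser at each state and turns the equation for the
    infimum over policies into one for a minimum over actions.\<close>
  obtain g where g: "greedy v g" using greedy_exists[OF v(1)] by blast
  have "is_arg_min (\<lambda>a. c (x, a) + \<alpha> * R v (x, a)) (\<lambda>a. a \<in> As x) (g x)"
    and "v x = c (x, g x) + \<alpha> * R v (x, g x)" if "x \<in> X" for x
    using greedyD[OF g that] Fopt_eq_greedy[OF v(1) g that] v(2)[OF that]
    by (simp_all add: H_def is_arg_min_linorder)
  then have minimum: "\<forall>x\<in>X. \<exists>a. is_arg_min (\<lambda>a. c (x, a) + \<alpha> * R v (x, a)) (\<lambda>a. a \<in> As x) a \<and>
      v x = c (x, a) + \<alpha> * R v (x, a)" by blast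
  have unique: "\<forall>u\<in>Bw X w. (\<forall>x\<in>X. Fopt X A As c R \<alpha> u x = u x) \<longrightarrow> (\<forall>x\<in>X. u x = v x)"
    using Fopt_fixed_point_unique[OF _ _ v] by simp
  have optimal: "\<forall>x\<in>X. v x = Jopt X A As c R \<alpha> x" using fixed_point_eq_Jopt[OF v] by simp
  have fixed: "\<forall>x\<in>X. Fopt X A As c R \<alpha> v x = v x" using v(2) by blast
  show ?thesis by (rule bexI[OF _ v(1)]) (intro conjI fixed unique minimum optimal)
qed

end
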